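(* Let $n\geq 2$. Any finitely generated subgroup of the Higman-Thompson group $V_n$ which contains no free subsemigroup on two generators is virtually abelian.
   Context: For $n\ge 2$, let $K_n\subset[0,1]$ be the Cantor set obtained by starting with $[0,1]$ and, at each step, dividing each remaining closed interval into $2n-1$ equal pieces and removing (the interiors of) the $n-1$ even-numbered ones, so that $n$ closed intervals remain ($K_2$ is the standard ternary Cantor set); $K_n$ is the intersection of the resulting decreasing sequence of compact sets. An interval of $K_n$ is the intersection of $K_n$ with one of the closed intervals appearing in this construction. The Higman-Thompson group $V_n$ is the group of homeomorphisms $f$ of $K_n$ for which there are two finite partitions $\{I_1,\dots,I_m\}$ and $\{J_1,\dots,J_m\}$ of $K_n$ by intervals of $K_n$, and a permutation $\sigma$ of $\{1,\dots,m\}$, such that for each $i$ the restriction of $f$ to $I_i$ is the restriction of the unique orientation-preserving affine map sending $I_i$ onto $J_{\sigma(i)}$. A group is virtually abelian if it contains an abelian subgroup of finite index. *)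

theory Defs
  imports
    "HOL-Analysis.Analysis"
    "HOL-Algebra.Bij"
    "HOL-Algebra.Generated_Groups"
    "HOL-Library.Disjoint_Sets"
    "HOL-Combinatorics.Permutations"
begin

(* A pair (a, b) stands for the closed interval {a..b}. With pieces of (a, b) numbered
   1, ..., 2n - 1 from the left, j < n ranges over the kept odd-numbered pieces 2j + 1. *)
primrec cantor_stage :: "nat \<Rightarrow> nat \<Rightarrow> (real \<times> real) set" where
  "cantor_stage n 0 = {(0, 1)}"
| "cantor_stage n (Suc k) =
     {(a + 2 * real j * ((b - a) / (2 * real n - 1)),
       a + (2 * real j + 1) * ((b - a) / (2 * real n - 1))) | a b j.
       (a, b) \<in> cantor_stage n k \<and> j < n}"

definition cantor_set :: "nat \<Rightarrow> real set" where
  "cantor_set n = (\<Inter>k. \<Union>(a, b)\<in>cantor_stage n k. {a..b})"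

definition cantor_interval :: "nat \<Rightarrow> real set \<Rightarrow> bool" where
  "cantor_interval n I \<longleftrightarrow> (\<exists>k a b. (a, b) \<in> cantor_stage n k \<and> I = cantor_set n \<inter> {a..b})"

(* For n \<ge> 2 every interval of the Cantor set has at least two points,
   so the coefficients c, d below are determined by A and B. *)
definition affine_between :: "(real \<Rightarrow> real) \<Rightarrow> real set \<Rightarrow> real set \<Rightarrow> bool" where
  "affine_between f A B \<longleftrightarrow>
     (\<exists>c d. c > 0 \<and> (\<lambda>x. c * x + d) ` A = B \<and> (\<forall>x\<in>A. f x = c * x + d))"

definition higman_thompson_map :: "nat \<Rightarrow> (real \<Rightarrow> real) \<Rightarrow> bool" where
  "higman_thompson_map n f \<longleftrightarrow>
     (\<exists>g. homeomorphism (cantor_set n) (cantor_set n) f g) \<and>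
     (\<exists>(m::nat) I J \<sigma>.
        (\<forall>i\<in>{1..m}. cantor_interval n (I i) \<and> cantor_interval n (J i)) \<and>
        inj_on I {1..m} \<and> partition_on (cantor_set n) (I ` {1..m}) \<and>
        inj_on J {1..m} \<and> partition_on (cantor_set n) (J ` {1..m}) \<and>
        \<sigma> permutes {1..m} \<and>
        (\<forall>i\<in>{1..m}. affine_between f (I i) (J (\<sigma> i))))"

(* A self-map of the Cantor set is represented by its extensional extension to the reals,
   as in BijGroup, so that equality in the group is equality of maps on the Cantor set. *)
definition higman_thompson :: "nat \<Rightarrow> (real \<Rightarrow> real) monoid" where
  "higman_thompson n = (BijGroup (cantor_set n))
     \<lparr>carrier := {f \<in> extensional (cantor_set n). higman_thompson_map n f}\<rparr>"

definition finitely_generated :: "('a, 'b) monoid_scheme \<Rightarrow> bool" where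
  "finitely_generated G \<longleftrightarrow> (\<exists>S. finite S \<and> S \<subseteq> carrier G \<and> generate G S = carrier G)"

(* T is a subsemigroup of G that is free with basis X: taking products identifies T with
   the free semigroup of nonempty words over X. *)
definition free_subsemigroup :: "('a, 'b) monoid_scheme \<Rightarrow> 'a set \<Rightarrow> 'a set \<Rightarrow> bool" where
  "free_subsemigroup G X T \<longleftrightarrow>
     X \<subseteq> carrier G \<and> bij_betw (\<lambda>w. foldr (mult G) w \<one>\<^bsub>G\<^esub>) (lists X - {[]}) T"

definition virtually_abelian :: "('a, 'b) monoid_scheme \<Rightarrow> bool" where
  "virtually_abelian G \<longleftrightarrow>
     (\<exists>A. subgroup A G \<and> comm_group (G\<lparr>carrier := A\<rparr>) \<and> finite (rcosets\<^bsub>G\<^esub> A))"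

end

theory Submission
  imports Defs "HOL-Library.Sublist"
begin

text \<open>Points of the Cantor set are infinite words over \<open>n\<close> letters, and an
  element of the Higman-Thompson group replaces prefixes. Let \<open>G\<close> be finitely
  generated without free subsemigroup. Following words in the generators until an image cylinder
  becomes large, and playing ping-pong, one sees that each point is either
  \<^emph>\<open>tame\<close> (all of \<open>G\<close> acts by prefix replacement on one of its
  cylinders) or \<^emph>\<open>hyperbolic\<close> (an attracting fixed point of some
  \<open>f\<close> in \<open>G\<close>). Ping-pong also isolates a hyperbolic point
  \<open>z\<close> in its orbit. An element \<open>h\<close> that is trivial near
  \<open>z\<close> is trivial on the whole basin of \<open>z\<close>, as otherwise
  \<open>f\<close> and \<open>h f\<close> generate a free semigroup; as germs at a common fixed
  point commute, so do elements fixing \<open>z\<close> on the basin. A minimal set of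
  hyperbolic points is a finite orbit, and from this the hyperbolic points are finitely many. An
  orbit meets a tame cylinder at most once, so it is finite or enters a basin. By compactness,
  the elements that fix all hyperbolic points and finitely many further points with finite
  orbits form an abelian subgroup of finite index.\<close>

section \<open>Coding of the Cantor set by words\<close>

text \<open>The contraction of [0, 1] onto the construction interval with address \<open>u\<close>
  over the letters 0, ..., n - 1. The first letter is the coarsest choice, and \<open>j\<close>
  selects the kept piece 2j + 1.\<close>

primrec cantor_map :: "nat \<Rightarrow> nat list \<Rightarrow> real \<Rightarrow> real" where
  "cantor_map n [] t = t"
| "cantor_map n (j # w) t = (2 * real j + cantor_map n w t) / (2 * real n - 1)"

definition cylinder :: "nat \<Rightarrow> nat list \<Rightarrow> real set" where
  "cylinder n u = cantor_map n u ` cantor_set n"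

lemma cantor_map_append: "cantor_map n (u @ v) t = cantor_map n u (cantor_map n v t)"
  by (induction u) auto

lemma cantor_map_eq: "cantor_map n u t = cantor_map n u 0 + t / (2 * real n - 1) ^ length u"
  by (induction u) (auto simp: add_divide_distrib mult.commute)

lemma cantor_map_affine: "cantor_map n u t = cantor_map n u 0 + t * (cantor_map n u 1 - cantor_map n u 0)"
  using cantor_map_eq[of n u t] cantor_map_eq[of n u 1] by simp

locale cantor_coding =
  fixes n :: nat
  assumes two_le: "2 \<le> n"
begin

abbreviation K :: "real set" where "K \<equiv> cantor_set n"
abbreviation W :: "nat list set" where "W \<equiv> lists {..<n}"
abbreviation \<phi> :: "nat list \<Rightarrow> real \<Rightarrow> real" where "\<phi> \<equiv> cantor_map n"
abbreviation C :: "nat list \<Rightarrow> real set" where "C \<equiv> cylinder n"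

lemma scale_ge: "2 * real n - 1 \<ge> 3"
  using two_le by linarith

lemma cantor_map_unit: "u \<in> W \<Longrightarrow> t \<in> {0..1} \<Longrightarrow> \<phi> u t \<in> {0..1}"
proof (induction u)
  case (Cons j u)
  then have "real j + 1 \<le> real n" "\<phi> u t \<in> {0..1}" by auto
  then show ?case using scale_ge by (auto simp: divide_simps)
qed auto

text \<open>A removed piece lies between any two kept neighbours, so even the closed kept pieces are
  disjoint: 2i and 2j differ by at most 1 only if i = j.\<close>

lemma cantor_map_unit_inj:
  assumes "u \<in> W" "v \<in> W" "length u = length v" "s \<in> {0..1}" "t \<in> {0..1}" "\<phi> u s = \<phi> v t"
  shows "u = v \<and> s = t"
  using assms
proof (induction u arbitrary: v)
  case (Cons i u)
  then obtain j v' where v: "v = j # v'" by (cases v) auto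
  have *: "\<phi> u s \<in> {0..1}" "\<phi> v' t \<in> {0..1}" using Cons v cantor_map_unit by auto
  have "2 * real i + \<phi> u s = 2 * real j + \<phi> v' t"
    using Cons.prems(5) scale_ge by (simp add: v)
  then have "\<bar>2 * real i - 2 * real j\<bar> \<le> 1" using * by auto
  then have "i = j" by linarith
  moreover have "\<phi> u s = \<phi> v' t"
    using \<open>2 * real i + \<phi> u s = 2 * real j + \<phi> v' t\<close> \<open>i = j\<close> by simp
  then have "u = v' \<and> s = t" by (intro Cons.IH) (use Cons.prems v in auto)
  ultimately show ?case using v by simp
qed auto

text \<open>Subdividing a stage interval refines its address at the end, while
  \<open>cantor_map\<close> recurses at the front; \<open>cantor_map_append\<close>
  mediates.\<close>

lemma cantor_stage_eq:
  "cantor_stage n k = {(\<phi> u 0, \<phi> u 1) | u. u \<in> W \<and> length u = k}"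
proof (induction k)
  case 0
  show ?case by auto
next
  case (Suc k)
  have ends: "\<phi> u 0 + x * ((\<phi> u 1 - \<phi> u 0) / (2 * real n - 1)) = \<phi> u (x / (2 * real n - 1))" for u x
    using cantor_map_affine[of n u "x / (2 * real n - 1)"] by simp
  have "cantor_stage n (Suc k) = {(\<phi> (u @ [j]) 0, \<phi> (u @ [j]) 1) | u j. u \<in> W \<and> length u = k \<and> j < n}"
  proof -
    have "(p \<in> cantor_stage n (Suc k)) = (\<exists>u j. p = (\<phi> (u @ [j]) 0, \<phi> (u @ [j]) 1) \<and> u \<in> W \<and> length u = k \<and> j < n)" for p
    proof -
      have "(p \<in> cantor_stage n (Suc k)) = (\<exists>u j. p = (\<phi> u 0 + 2 * real j * ((\<phi> u 1 - \<phi> u 0) / (2 * real n - 1)),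
          \<phi> u 0 + (2 * real j + 1) * ((\<phi> u 1 - \<phi> u 0) / (2 * real n - 1))) \<and> u \<in> W \<and> length u = k \<and> j < n)"
        unfolding cantor_stage.simps Suc by blast
      then show ?thesis unfolding ends by (simp add: cantor_map_append)
    qed
    then show ?thesis by blast
  qed
  also have "\<dots> = {(\<phi> u 0, \<phi> u 1) | u. u \<in> W \<and> length u = Suc k}"
    (is "?A = ?B")
  proof
    show "?A \<subseteq> ?B" by fastforce
    show "?B \<subseteq> ?A"
    proof
      fix p assume "p \<in> ?B"
      then obtain v where v: "p = (\<phi> v 0, \<phi> v 1)" "v \<in> W" "length v = Suc k" by blast
      then obtain u j where "v = u @ [j]" by (metis length_Suc_conv_rev)
      then show "p \<in> ?A" using v by auto
    qed
  qed
  finally show ?case .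
qed

lemma cantor_map_interval: "\<phi> u ` {0..1} = {\<phi> u 0..\<phi> u 1}"
proof -
  define c where "c = 1 / (2 * real n - 1) ^ length u"
  have c: "c > 0" using scale_ge by (simp add: c_def)
  have eq: "\<phi> u t = c * t + \<phi> u 0" for t
    using cantor_map_eq[of n u t] by (simp add: c_def)
  have "(\<lambda>t. c * t + \<phi> u 0) ` {0..1} = {c * 0 + \<phi> u 0..c * 1 + \<phi> u 0}"
    using c by (subst image_affinity_atLeastAtMost) auto
  moreover have "\<phi> u ` {0..1} = (\<lambda>t. c * t + \<phi> u 0) ` {0..1}" by (intro image_cong refl eq)
  ultimately show ?thesis using eq[of 1] by simp
qed

section \<open>Self-similarity of the Cantor set and nesting of cylinders\<close>

lemma mem_cantor_set_iff:
  "x \<in> K \<longleftrightarrow> (\<forall>k. \<exists>u\<in>W. length u = k \<and> x \<in> \<phi> u ` {0..1})"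
  unfolding cantor_set_def cantor_stage_eq by (auto simp: cantor_map_interval) blast+

lemma cantor_set_unit: "x \<in> K \<Longrightarrow> x \<in> {0..1}"
  unfolding mem_cantor_set_iff by (drule spec[of _ 0]) auto

lemma cantor_map_in: "u \<in> W \<Longrightarrow> t \<in> K \<Longrightarrow> \<phi> u t \<in> K"
proof (induction u)
  case (Cons j u)
  then have t: "\<phi> u t \<in> K" and j: "j < n" by auto
  show ?case unfolding mem_cantor_set_iff
  proof
    fix k
    show "\<exists>v\<in>W. length v = k \<and> \<phi> (j # u) t \<in> \<phi> v ` {0..1}"
    proof (cases k)
      case 0
      have "\<phi> (j # u) t \<in> {0..1}"
        using cantor_map_unit Cons.prems cantor_set_unit by metis
      with 0 show ?thesis by (intro bexI[of _ "[]"]) auto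
    next
      case (Suc m)
      obtain v s where "v \<in> W" "length v = m" "s \<in> {0..1}" "\<phi> u t = \<phi> v s"
        using t[unfolded mem_cantor_set_iff] by blast
      then show ?thesis using Suc j by (intro bexI[of _ "j # v"]) auto
    qed
  qed
qed auto

text \<open>Addresses of \<open>x\<close> of all positive lengths start with the same letter by
  injectivity; deleting that letter leaves addresses of \<open>t\<close> of all lengths.\<close>

lemma cantor_set_first_letter:
  assumes "x \<in> K" shows "\<exists>j<n. \<exists>t\<in>K. x = \<phi> [j] t"
proof -
  obtain u t where "u \<in> W" "length u = 1" and t: "t \<in> {0..1}" "x = \<phi> u t"
    using assms[unfolded mem_cantor_set_iff] by blast
  then obtain j where j: "u = [j]" "j < n" by (auto simp: length_Suc_conv)
  have "t \<in> K" unfolding mem_cantor_set_iff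
  proof
    fix k
    obtain v s where v: "v \<in> W" "length v = Suc k" "s \<in> {0..1}" "x = \<phi> v s"
      using assms[unfolded mem_cantor_set_iff] by blast
    then obtain i v' where v': "v = [i] @ v'" "i < n" "v' \<in> W" "length v' = k"
      by (cases v) auto
    then have "\<phi> [j] t = \<phi> [i] (\<phi> v' s)" using t v j by (simp only: cantor_map_append)
    then have "t = \<phi> v' s"
      using cantor_map_unit_inj[of "[j]" "[i]" t "\<phi> v' s"] cantor_map_unit[of v' s] t v v' j
        by auto
    then show "\<exists>v\<in>W. length v = k \<and> t \<in> \<phi> v ` {0..1}" using v v' by blast
  qed
  then show ?thesis using t j by auto
qed

lemma in_some_cylinder: "x \<in> K \<Longrightarrow> \<exists>u\<in>W. length u = k \<and> x \<in> C u"
proof (induction k arbitrary: x)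
  case 0
  then show ?case by (intro bexI[of _ "[]"]) (auto simp: cylinder_def)
next
  case (Suc k)
  obtain j t where j: "j < n" "t \<in> K" "x = \<phi> [j] t" using cantor_set_first_letter Suc by blast
  then obtain u where "u \<in> W" "length u = k" "t \<in> C u" using Suc by blast
  then show ?case using j by (intro bexI[of _ "j # u"]) (auto simp: cylinder_def)
qed

lemma cantor_map_inj:
  assumes "u \<in> W" "v \<in> W" "length u = length v" "s \<in> K" "t \<in> K" "\<phi> u s = \<phi> v t"
  shows "u = v \<and> s = t"
  using assms cantor_map_unit_inj cantor_set_unit by blast

lemma cylinder_subset: "u \<in> W \<Longrightarrow> C u \<subseteq> K"
  using cantor_map_in by (auto simp: cylinder_def)

lemma cylinder_append: "v \<in> W \<Longrightarrow> C (u @ v) \<subseteq> C u"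
  using cantor_map_in by (auto simp: cylinder_def cantor_map_append)

lemma cylinder_Nil [simp]: "C [] = K"
  by (auto simp: cylinder_def)

text \<open>Cylinders are nested or disjoint: the prefix of \<open>v\<close> that is as long as
  \<open>u\<close> also has \<open>x\<close> in its cylinder, and words of equal length sharing a
  point coincide.\<close>

lemma cylinders_meet:
  assumes "u \<in> W" "v \<in> W" "x \<in> C u" "x \<in> C v" "length u \<le> length v"
  shows "\<exists>w\<in>W. v = u @ w"
proof -
  define a b where "a = take (length u) v" and "b = drop (length u) v"
  have v: "v = a @ b" "length a = length u" using assms by (auto simp: a_def b_def)
  have ab: "a \<in> W" "b \<in> W" using assms(2) v by auto
  obtain s t where "s \<in> K" "t \<in> K" "x = \<phi> u s" "x = \<phi> a (\<phi> b t)"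
    using assms by (auto simp: cylinder_def v cantor_map_append)
  then have "u = a"
    using cantor_map_inj[of u a s "\<phi> b t"] assms(1) ab v(2) cantor_map_in by simp
  then show ?thesis using v ab by blast
qed

lemma cylinder_mono:
  assumes "u \<in> W" "v \<in> W" "x \<in> C u" "x \<in> C v" "length u \<le> length v"
  shows "C v \<subseteq> C u"
  using cylinders_meet[OF assms] cylinder_append by auto

lemma cylinder_refine:
  assumes "u \<in> W" "v \<in> W" "x \<in> C u" "x \<in> C v"
  obtains w where "w \<in> W" "x \<in> C w" "C w \<subseteq> C u" "C w \<subseteq> C v" "length w \<ge> k"
proof -
  have "x \<in> K" using assms cylinder_subset by auto
  then obtain w where w: "w \<in> W" "length w = max k (max (length u) (length v))" "x \<in> C w"
    using in_some_cylinder by blast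
  then show thesis
    using that[of w] cylinder_mono[of u w x] cylinder_mono[of v w x] assms by auto
qed

text \<open>The contractions of the letters 0 and n - 1 fix 0 and 1 respectively. Hence every
  cylinder contains two distinct points, which pin down an affine map.\<close>

lemma zero_one_mem: "0 \<in> K" "1 \<in> K"
proof -
  have 0: "\<phi> (replicate k 0) 0 = 0" for k by (induction k) auto
  have 1: "\<phi> (replicate k (n - 1)) 1 = 1" for k
    using two_le by (induction k) (auto simp: of_nat_diff)
  have "replicate k 0 \<in> W" "replicate k (n - 1) \<in> W" for k using two_le by auto
  then show "0 \<in> K" "1 \<in> K" unfolding mem_cantor_set_iff
    using 0 1 by (force intro!: bexI[of _ "replicate _ 0"] image_eqI[of _ _ 0],
      force intro!: bexI[of _ "replicate _ (n - 1)"] image_eqI[of _ _ 1])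
qed

lemma finite_words: "finite {u \<in> W. length u = k}"
  using finite_lists_length_eq[of "{..<n}" k]
    by (simp add: lists_eq_set Collect_conj_eq Int_commute)

lemma finite_words_less: "finite {u \<in> W. length u < k}"
proof (rule finite_subset)
  show "{u \<in> W. length u < k} \<subseteq> (\<Union>i<k. {u \<in> W. length u = i})" by auto
qed (use finite_words in auto)

section \<open>Topology and size of cylinders\<close>

lemma cantor_map_continuous: "continuous_on A (\<phi> u)"
proof -
  have "continuous_on A (\<lambda>t. \<phi> u 0 + t / (2 * real n - 1) ^ length u)"
    using scale_ge by (intro continuous_intros) auto
  then show ?thesis unfolding cantor_map_eq[of n u, symmetric] .
qed

lemma compact_cantor_set: "compact K"
proof -
  have "finite (cantor_stage n k)" for k
    unfolding cantor_stage_eq using finite_words by (simp add: setcompr_eq_image)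
  then have "closed K" unfolding cantor_set_def by (auto intro!: closed_INT closed_UN)
  moreover have "K \<subseteq> {0..1}" using cantor_set_unit by blast
  ultimately show ?thesis
    using bounded_subset[OF bounded_closed_interval] compact_eq_bounded_closed by blast
qed

lemma compact_cylinder: "compact (C u)"
  unfolding cylinder_def
    by (intro compact_continuous_image cantor_map_continuous compact_cantor_set)

text \<open>The other cylinders of the same word length are finitely many compact sets and make up
  exactly the rest of \<open>K\<close>.\<close>

lemma cylinder_open:
  assumes "u \<in> W" obtains T where "open T" "C u = K \<inter> T"
proof -
  define D where "D = \<Union> (C ` ({v \<in> W. length v = length u} - {u}))"
  have "closed D" unfolding D_def
    using finite_words compact_cylinder by (intro closed_Union) (auto intro: compact_imp_closed)
  moreover have "x \<in> C u \<longleftrightarrow> x \<notin> D" if "x \<in> K" for x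
  proof -
    obtain v where v: "v \<in> W" "length v = length u" "x \<in> C v"
      using in_some_cylinder \<open>x \<in> K\<close> by blast
    have w: "v = w" if w: "w \<in> W" "length w = length u" "x \<in> C w" for w
    proof -
      obtain w' where "w = v @ w'" using v w cylinders_meet[of v w x] by auto
      then show ?thesis using v w by simp
    qed
    show ?thesis
    proof
      assume "x \<in> C u"
      then show "x \<notin> D" using w assms unfolding D_def by blast
    next
      assume "x \<notin> D"
      then show "x \<in> C u" using v unfolding D_def by blast
    qed
  qed
  then have "C u = K \<inter> - D" using cylinder_subset[OF assms] by blast
  ultimately show thesis using that[of "- D"] by auto
qed

text \<open>The cylinder of a word of length N has diameter at most (1/3)^N.\<close>

lemma points_separated:
  assumes "x \<noteq> y"
  shows "\<exists>N. \<forall>u. x \<in> C u \<longrightarrow> y \<in> C u \<longrightarrow> length u < N"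
proof -
  obtain N where N: "(1 / 3) ^ N < \<bar>x - y\<bar>"
    using assms real_arch_pow_inv[of "\<bar>x - y\<bar>" "1/3"] by auto
  have "length u < N" if xy: "x \<in> C u" "y \<in> C u" for u
  proof (rule ccontr)
    assume "\<not> length u < N"
    obtain s t where st: "s \<in> {0..1}" "t \<in> {0..1}" "x = \<phi> u s" "y = \<phi> u t"
      using xy cantor_set_unit unfolding cylinder_def by blast
    define q where "q = 1 / (2 * real n - 1)"
    have q: "0 \<le> q" "q \<le> 1/3" using scale_ge by (auto simp: q_def divide_simps)
    have "x - y = (s - t) * q ^ length u"
      using st cantor_map_eq[of n u s] cantor_map_eq[of n u t]
      by (simp add: q_def power_one_over divide_simps left_diff_distrib)
    then have "\<bar>x - y\<bar> = \<bar>s - t\<bar> * q ^ length u" using q by (simp add: abs_mult)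
    also have "\<dots> \<le> 1 * q ^ length u" using st q by (intro mult_right_mono) auto
    also have "\<dots> \<le> (1/3) ^ length u" using q by (auto intro: power_mono)
    also have "\<dots> \<le> (1/3) ^ N" using \<open>\<not> length u < N\<close> by (intro power_decreasing) auto
    finally show False using N by simp
  qed
  then show ?thesis by blast
qed

text \<open>The values at 0 and 1 give the slope, hence the length of the word; words of equal
  length are told apart by injectivity. This makes the image prefix of a prefix replacement
  unique.\<close>

lemma cantor_map_determined:
  assumes "u \<in> W" "v \<in> W" "\<And>t. t \<in> K \<Longrightarrow> \<phi> u t = \<phi> v t"
  shows "u = v"
proof -
  have "1 / (2 * real n - 1) ^ length u = 1 / (2 * real n - 1) ^ length v"
    using assms(3)[of 0] assms(3)[of 1] zero_one_mem cantor_map_eq[of n u 1] cantor_map_eq[of n v 1] by simp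
  then have "length u = length v" using scale_ge by (simp add: power_inject_exp)
  then show ?thesis using cantor_map_inj[of u v 0 0] assms zero_one_mem by blast
qed

section \<open>Intervals of the Cantor set and the affine maps between them\<close>

text \<open>A point of \<open>K\<close> in the closed interval addressed by \<open>u\<close> lies in
  the cylinder of some word of the same length; closed construction intervals of one stage being
  disjoint, that word is \<open>u\<close>.\<close>

lemma cantor_interval_cylinder:
  assumes "cantor_interval n I" obtains u where "u \<in> W" "I = C u"
proof -
  obtain u where u: "u \<in> W" "I = K \<inter> \<phi> u ` {0..1}"
    using assms unfolding cantor_interval_def cantor_stage_eq
      by (auto simp: cantor_map_interval)
  have "I = C u"
  proof
    show "C u \<subseteq> I" using u cantor_map_in cantor_set_unit by (auto simp: cylinder_def)
    show "I \<subseteq> C u"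
    proof
      fix x assume "x \<in> I"
      then obtain s where "x \<in> K" "s \<in> {0..1}" "x = \<phi> u s" using u by auto
      moreover obtain v t where "v \<in> W" "length v = length u" "t \<in> K" "x = \<phi> v t"
        using in_some_cylinder[OF \<open>x \<in> K\<close>, of "length u"] unfolding cylinder_def by blast
      ultimately have "u = v \<and> s = t"
        by (intro cantor_map_unit_inj[of u v s t]) (use u cantor_set_unit in simp_all)
      then show "x \<in> C u" using \<open>t \<in> K\<close> \<open>x = \<phi> u s\<close> by (auto simp: cylinder_def)
    qed
  qed
  then show thesis using that u by blast
qed

text \<open>An increasing affine map of one cylinder onto another matches least and greatest points,
  so it is the change of coding maps.\<close>

lemma affine_between_cylinders:
  assumes "u \<in> W" "v \<in> W" "affine_between f (C u) (C v)" "t \<in> K"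
  shows "f (\<phi> u t) = \<phi> v t"
proof -
  obtain c d where c: "c > 0" and im: "(\<lambda>x. c * x + d) ` C u = C v"
    and f: "\<And>x. x \<in> C u \<Longrightarrow> f x = c * x + d"
    using assms(3) unfolding affine_between_def by blast
  have bounds: "\<phi> w 0 \<le> x \<and> x \<le> \<phi> w 1" if "x \<in> C w" for w x
    using that cantor_map_interval[of w] cantor_set_unit
    by (auto simp: cylinder_def simp flip: atLeastAtMost_iff)
  have ends: "\<phi> w 0 \<in> C w" "\<phi> w 1 \<in> C w" for w using zero_one_mem by (auto simp: cylinder_def)
  have img: "c * x + d \<in> C v" if "x \<in> C u" for x using im that by blast
  have pre: "\<exists>x\<in>C u. y = c * x + d" if "y \<in> C v" for y using im that by blast
  obtain x0 x1 where x: "x0 \<in> C u" "\<phi> v 0 = c * x0 + d" "x1 \<in> C u" "\<phi> v 1 = c * x1 + d"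
    using pre ends by metis
  have "c * \<phi> u 0 + d = \<phi> v 0"
    using x bounds[OF x(1)] bounds[OF img[OF ends(1)]] c mult_left_mono[of "\<phi> u 0" x0 c]
      by linarith
  moreover have "c * \<phi> u 1 + d = \<phi> v 1"
    using x bounds[OF x(3)] bounds[OF img[OF ends(2)]] c mult_left_mono[of x1 "\<phi> u 1" c]
      by linarith
  moreover have "c * (\<phi> u 0 + t * (\<phi> u 1 - \<phi> u 0)) + d
      = (c * \<phi> u 0 + d) + t * ((c * \<phi> u 1 + d) - (c * \<phi> u 0 + d))"
    by (simp add: algebra_simps)
  ultimately have "c * (\<phi> u 0 + t * (\<phi> u 1 - \<phi> u 0)) + d = \<phi> v 0 + t * (\<phi> v 1 - \<phi> v 0)"
    by simp
  then have "c * \<phi> u t + d = \<phi> v t"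
    using cantor_map_affine[of n u t] cantor_map_affine[of n v t] by simp
  then show ?thesis using f assms(4) by (auto simp: cylinder_def)
qed

end

section \<open>Free subsemigroups and prefix replacement\<close>

text \<open>On addresses, \<open>f\<close> turns the prefix \<open>u\<close> into \<open>v\<close>
  and keeps the tail. It contracts exactly when \<open>v\<close> is longer than
  \<open>u\<close>.\<close>

definition replaces_prefix :: "nat \<Rightarrow> (real \<Rightarrow> real) \<Rightarrow> nat list \<Rightarrow> nat list \<Rightarrow> bool" where
  "replaces_prefix n f u v \<longleftrightarrow> (\<forall>t\<in>cantor_set n. f (cantor_map n u t) = cantor_map n v t)"

abbreviation repeat :: "'a list \<Rightarrow> nat \<Rightarrow> 'a list" where
  "repeat w k \<equiv> concat (replicate k w)"

lemma repeat_commute: "repeat w k @ w = w @ repeat w k"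
  by (induction k) auto

lemma length_repeat: "length (repeat w k) = k * length w"
  by (induction k) auto

lemma repeat_in_lists: "w \<in> lists A \<Longrightarrow> repeat w k \<in> lists A"
  by (induction k) auto

abbreviation word_product :: "('a, 'b) monoid_scheme \<Rightarrow> 'a list \<Rightarrow> 'a" where
  "word_product G w \<equiv> foldr (mult G) w \<one>\<^bsub>G\<^esub>"

context monoid
begin

lemma word_product_closed: "set w \<subseteq> carrier G \<Longrightarrow> word_product G w \<in> carrier G"
  by (induction w) auto

lemma word_product_append:
  "set v \<subseteq> carrier G \<Longrightarrow> set w \<subseteq> carrier G \<Longrightarrow>
    word_product G (v @ w) = word_product G v \<otimes> word_product G w"
  by (induction v) (auto simp: m_assoc word_product_closed)

lemma no_free_subsemigroup_collision:
  assumes "\<nexists>X T. card X = 2 \<and> free_subsemigroup G X T"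
    and "a \<in> carrier G" "b \<in> carrier G" "a \<noteq> b"
  obtains v w where "v \<in> lists {a, b}" "w \<in> lists {a, b}" "v \<noteq> w"
    "word_product G v = word_product G w"
proof -
  have "\<not> inj_on (word_product G) (lists {a, b} - {[]})"
  proof
    assume "inj_on (word_product G) (lists {a, b} - {[]})"
    then have "free_subsemigroup G {a, b} (word_product G ` (lists {a, b} - {[]}))"
      using assms(2,3) by (simp add: free_subsemigroup_def inj_on_imp_bij_betw)
    moreover have "card {a, b} = 2" using assms(4) by simp
    ultimately show False using assms(1) by blast
  qed
  then show thesis using that unfolding inj_on_def by blast
qed

end

text \<open>What the argument uses of a subgroup of V_n: a faithful action on \<open>K\<close>,
  finite generation, no free subsemigroup, and prefix replacement on all cylinders of large depth,
  which stands in for the finite partitions.\<close>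

locale cantor_group = cantor_coding n + group G for n and G (structure) +
  assumes mult_apply: "\<lbrakk>f \<in> carrier G; g \<in> carrier G; x \<in> cantor_set n\<rbrakk> \<Longrightarrow> (f \<otimes> g) x = f (g x)"
    and one_apply: "x \<in> cantor_set n \<Longrightarrow> \<one> x = x"
    and apply_closed: "\<lbrakk>f \<in> carrier G; x \<in> cantor_set n\<rbrakk> \<Longrightarrow> f x \<in> cantor_set n"
    and faithful: "\<lbrakk>f \<in> carrier G; \<And>x. x \<in> cantor_set n \<Longrightarrow> f x = x\<rbrakk> \<Longrightarrow> f = \<one>"
    and uniformly_affine: "f \<in> carrier G \<Longrightarrow>
      \<exists>N. \<forall>u\<in>lists {..<n}. N \<le> length u \<longrightarrow> (\<exists>v\<in>lists {..<n}. replaces_prefix n f u v)"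
    and fg: "\<exists>S. finite S \<and> S \<subseteq> carrier G \<and> generate G S = carrier G"
    and no_free: "\<nexists>X T. card X = 2 \<and> free_subsemigroup G X T"
begin

section \<open>Calculus of prefix replacement\<close>

abbreviation aff :: "(real \<Rightarrow> real) \<Rightarrow> nat list \<Rightarrow> nat list \<Rightarrow> bool" where
  "aff \<equiv> replaces_prefix n"

lemma inv_apply:
  assumes "f \<in> carrier G" "x \<in> K"
  shows "(inv f) (f x) = x" "f ((inv f) x) = x"
  using assms mult_apply[of "inv f" f x] mult_apply[of f "inv f" x] one_apply by auto

lemma apply_inj: "f \<in> carrier G \<Longrightarrow> x \<in> K \<Longrightarrow> y \<in> K \<Longrightarrow> f x = f y \<Longrightarrow> x = y"
  using inv_apply(1) by metis

lemma aff_append: "aff f u v \<Longrightarrow> w \<in> W \<Longrightarrow> aff f (u @ w) (v @ w)"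
  using cantor_map_in by (auto simp: replaces_prefix_def cantor_map_append)

lemma aff_mult:
  "\<lbrakk>f \<in> carrier G; g \<in> carrier G; u \<in> W; aff g u v; aff f v w\<rbrakk> \<Longrightarrow> aff (f \<otimes> g) u w"
  using cantor_map_in by (auto simp: replaces_prefix_def mult_apply)

lemma aff_one: "u \<in> W \<Longrightarrow> aff \<one> u u"
  using cantor_map_in one_apply by (auto simp: replaces_prefix_def)

lemma aff_inv:
  assumes "f \<in> carrier G" "u \<in> W" "aff f u v" shows "aff (inv f) v u"
  unfolding replaces_prefix_def
proof
  fix t assume "t \<in> K"
  then have "\<phi> v t = f (\<phi> u t)" "\<phi> u t \<in> K"
    using assms cantor_map_in by (auto simp: replaces_prefix_def)
  then show "(inv f) (\<phi> v t) = \<phi> u t" using inv_apply assms by simp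
qed

lemma aff_unique: "v \<in> W \<Longrightarrow> w \<in> W \<Longrightarrow> aff f u v \<Longrightarrow> aff f u w \<Longrightarrow> v = w"
  by (rule cantor_map_determined) (auto simp: replaces_prefix_def)

lemma aff_image: "aff f u v \<Longrightarrow> f ` C u = C v"
  by (force simp: replaces_prefix_def cylinder_def)

lemma aff_id: "u \<in> W \<Longrightarrow> aff f u u \<longleftrightarrow> (\<forall>x\<in>C u. f x = x)"
  by (auto simp: replaces_prefix_def cylinder_def)

lemma aff_repeat:
  assumes "w \<in> W" "aff f u (u @ w)"
  shows "aff f (u @ repeat w k) (u @ repeat w (Suc k))"
  using aff_append[OF assms(2) repeat_in_lists[OF assms(1)]] by simp

lemma aff_pow:
  assumes "f \<in> carrier G" "u \<in> W" "w \<in> W" "aff f u (u @ w)"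
  shows "aff (f [^] k) u (u @ repeat w k)"
proof (induction k)
  case 0
  then show ?case using aff_one assms by simp
next
  case (Suc k)
  have "aff (f \<otimes> f [^] k) u (u @ repeat w (Suc k))"
    using aff_mult[OF _ _ _ Suc aff_repeat[OF assms(3,4)]] assms by simp
  then show ?case using assms nat_pow_Suc2 by metis
qed

lemma pow_add_apply: "f \<in> carrier G \<Longrightarrow> x \<in> K \<Longrightarrow> (f [^] Suc k) x = f ((f [^] k) x)"
  using nat_pow_Suc2[of f k] mult_apply[of f "f [^] k" x] by simp

lemma pow_fixed: "f \<in> carrier G \<Longrightarrow> x \<in> K \<Longrightarrow> f x = x \<Longrightarrow> (f [^] (k::nat)) x = x"
proof (induction k)
  case (Suc k)
  then show ?case using pow_add_apply[of f x k] by simp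
qed (simp add: one_apply)

lemma extend_word:
  assumes "u \<in> W" "x \<in> C u" obtains s where "s \<in> W" "length s = k" "x \<in> C (u @ s)"
proof -
  obtain t where t: "t \<in> K" "x = \<phi> u t" using assms by (auto simp: cylinder_def)
  then obtain s where "s \<in> W" "length s = k" "t \<in> C s" using in_some_cylinder by blast
  then show thesis using that t by (auto simp: cylinder_def cantor_map_append)
qed

lemma locally_aff:
  assumes "g \<in> carrier G" "x \<in> K" "u \<in> W" "g x \<in> C u"
  obtains r v where "r \<in> W" "v \<in> W" "x \<in> C r" "aff g r v" "C v \<subseteq> C u" "k \<le> length r" "k \<le> length v"
proof -
  obtain N where N: "\<And>u. u \<in> W \<Longrightarrow> N \<le> length u \<Longrightarrow> \<exists>v\<in>W. aff g u v"
    using uniformly_affine assms(1) by meson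
  obtain r where r: "r \<in> W" "length r = N" "x \<in> C r" using in_some_cylinder assms by blast
  then obtain v where v: "v \<in> W" "aff g r v" using N by blast
  \<comment> \<open>A tail of this length makes the image prefix at least as long as
    \<open>u\<close>, so its cylinder is inside \<open>C u\<close>, and gives both prefixes length
    at least \<open>k\<close>.\<close>
  obtain s where s: "s \<in> W" "length s = length u + k" "x \<in> C (r @ s)"
    using extend_word r by blast
  have av: "aff g (r @ s) (v @ s)" using aff_append v s by blast
  then have "g x \<in> C (v @ s)" using aff_image s(3) by blast
  then have "C (v @ s) \<subseteq> C u" using cylinder_mono[of u "v @ s" "g x"] assms v s by auto
  then show thesis using that[of "r @ s" "v @ s"] r v s av by auto
qed

section \<open>Ping-pong and relations between words\<close>

text \<open>Two distinct words have equal products. Once the longest common prefix is cancelled, the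
  remainders start with different letters and send a point of \<open>U\<close> into disjoint images;
  a remainder may also be empty, which \<open>one\<close> excludes.\<close>

lemma ping_pong:
  assumes "a \<in> carrier G" "b \<in> carrier G" "U \<subseteq> K" "U \<noteq> {}"
    and "a ` U \<subseteq> U" "b ` U \<subseteq> U" "a ` U \<inter> b ` U = {}"
  shows False
proof -
  have "a \<noteq> b" using assms by auto
  then obtain v w where vw: "v \<in> lists {a, b}" "w \<in> lists {a, b}" "v \<noteq> w"
    "word_product G v = word_product G w"
    using no_free_subsemigroup_collision[OF no_free assms(1,2)] by metis
  obtain p v' w' where pre: "v = p @ v'" "w = p @ w'" "v' = [] \<or> w' = [] \<or> hd v' \<noteq> hd w'"
    using longest_common_prefix[of v w] by blast
  have sets: "set p \<subseteq> carrier G" "set v' \<subseteq> carrier G" "set w' \<subseteq> carrier G"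
    "set v' \<subseteq> {a, b}" "set w' \<subseteq> {a, b}"
    using vw pre assms(1,2) by auto
  then have eq: "word_product G v' = word_product G w'"
    using vw(4) pre word_product_append word_product_closed by (metis Units_eq Units_l_cancel)
  have into: "x \<in> U \<Longrightarrow> set s \<subseteq> {a, b} \<Longrightarrow> word_product G s x \<in> U" for x s
  proof (induction s)
    case (Cons c s)
    have "set s \<subseteq> carrier G" "c \<in> carrier G" using Cons.prems assms(1,2) by auto
    then have "word_product G (c # s) x = c (word_product G s x)"
      using mult_apply word_product_closed Cons.prems assms(3) by auto
    then show ?case using Cons assms(5,6) by auto
  qed (use one_apply assms in auto)
  have hd: "word_product G s x \<in> hd s ` U" if s0: "s \<noteq> []" "set s \<subseteq> {a, b}" "x \<in> U" for s x
  proof -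
    obtain c r where s: "s = c # r" using s0 by (cases s) auto
    have "set r \<subseteq> carrier G" "c \<in> carrier G" using s0 s assms(1,2) by auto
    then have "word_product G s x = c (word_product G r x)"
      using mult_apply word_product_closed s0 assms(3) s by auto
    then show ?thesis using into s0 s by auto
  qed
  have hd_in: "s \<noteq> [] \<Longrightarrow> set s \<subseteq> {a, b} \<Longrightarrow> hd s \<in> {a, b}" for s by (cases s) auto
  have one: "word_product G s \<noteq> \<one>" if "s \<noteq> []" "set s \<subseteq> {a, b}" for s
  proof
    assume 1: "word_product G s = \<one>"
    have "x \<in> hd s ` U" if "x \<in> U" for x
      using hd[OF \<open>s \<noteq> []\<close> \<open>set s \<subseteq> {a, b}\<close> that] one_apply assms(3) that unfolding 1 by auto
    \<comment> \<open>Now the first letter maps \<open>U\<close> onto a set containing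
      \<open>U\<close>, hence containing the image of \<open>U\<close> under the other letter,
      against disjointness.\<close>
    then have "U \<subseteq> hd s ` U" by blast
    moreover have "hd s = a \<or> hd s = b" using hd_in[OF that] by blast
    ultimately have "b ` U \<subseteq> a ` U \<or> a ` U \<subseteq> b ` U" using assms(5,6) by (metis subset_trans)
    moreover obtain x where "x \<in> U" using assms(4) by blast
    then have "a x \<in> a ` U" "b x \<in> b ` U" by auto
    ultimately show False using assms(7) by blast
  qed
  obtain x where "x \<in> U" using assms(4) by blast
  consider "v' = []" | "w' = []" | "v' \<noteq> []" "w' \<noteq> []" by blast
  then show False
  proof cases
    case 1 then show False using one[of w'] eq sets pre vw(3) by auto
  next
    case 2 then show False using one[of v'] eq sets pre vw(3) by auto
  next
    case 3
    then have "word_product G v' x \<in> hd v' ` U" "word_product G w' x \<in> hd w' ` U"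
      using hd[OF _ _ \<open>x \<in> U\<close>] sets(4,5) by blast+
    then have "word_product G v' x \<in> hd v' ` U \<inter> hd w' ` U" using eq by simp
    moreover have "{hd v', hd w'} = {a, b}" using hd_in 3 sets pre(3) by blast
    ultimately show False using assms(7) by (auto simp: doubleton_eq_iff)
  qed
qed

text \<open>Both \<open>f\<close> and \<open>h \<otimes> f\<close> act on \<open>A\<close> as \<open>f\<close>, so a word in them acts on \<open>A\<close> through its
  length only, and a relation between two words of equal length with distinct last letters forces
  \<open>h\<close> to be trivial on \<open>A\<close>.\<close>

lemma trivial_on_preimage:
  assumes "f \<in> carrier G" "h \<in> carrier G" "A \<subseteq> K" "f ` A \<subseteq> A"
    and triv: "\<And>x. x \<in> A \<Longrightarrow> h (f x) = f x"
    and free: "\<And>k l::nat. (\<And>x. x \<in> A \<Longrightarrow> (f [^] k) x = (f [^] l) x) \<Longrightarrow> k = l"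
    and "x \<in> A"
  shows "h x = x"
proof (cases "f = h \<otimes> f")
  case True
  then have "h = \<one>" using assms(1,2) by (metis l_one one_closed right_cancel)
  then show ?thesis using one_apply assms by auto
next
  case False
  then obtain v w where vw: "v \<in> lists {f, h \<otimes> f}" "w \<in> lists {f, h \<otimes> f}" "v \<noteq> w"
    "word_product G v = word_product G w"
    using no_free_subsemigroup_collision[OF no_free, of f "h \<otimes> f"] assms(1,2)
      by (metis m_closed)
  have act: "word_product G s y = (f [^] length s) y \<and> word_product G s y \<in> A"
    if "y \<in> A" "set s \<subseteq> {f, h \<otimes> f}" for y s
    using that
  proof (induction s)
    case (Cons c s)
    have c: "set s \<subseteq> carrier G" "c \<in> carrier G" using Cons.prems assms(1,2) by auto
    then have 1: "word_product G (c # s) y = c (word_product G s y)"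
      using mult_apply word_product_closed Cons.prems assms(3) by auto
    have "word_product G s y \<in> A" and 2: "word_product G s y = (f [^] length s) y"
      using Cons by auto
    then have "c (word_product G s y) = f (word_product G s y)"
      using Cons.prems mult_apply assms(1-3) triv by auto
    then show ?case
      using 1 2 \<open>word_product G s y \<in> A\<close> assms(1,3,4) pow_add_apply[of f y "length s"] Cons.prems(1)
      by (auto simp del: nat_pow_Suc)
  qed (use one_apply assms in auto)
  have len: "length v = length w"
    using act vw free[of "length v" "length w"] by (metis in_lists_conv_set subset_code(1))
  obtain p v' w' where suf: "v = v' @ p" "w = w' @ p" "v' = [] \<or> w' = [] \<or> last v' \<noteq> last w'"
    using longest_common_suffix[of v w] by blast
  have len': "length v' = length w'" using len suf by simp
  then have ne: "v' \<noteq> []" "w' \<noteq> []" "last v' \<noteq> last w'" using suf vw(3) by auto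
  define r s where "r = butlast v'" and "s = butlast w'"
  have v': "v' = r @ [last v']" and w': "w' = s @ [last w']"
    using ne by (auto simp: r_def s_def)
  have rs: "set r \<subseteq> {f, h \<otimes> f}" "set s \<subseteq> {f, h \<otimes> f}" "last v' \<in> {f, h \<otimes> f}" "last w' \<in> {f, h \<otimes> f}"
    "length r = length s"
    using vw(1,2) suf ne len' last_in_set[OF ne(1)] last_in_set[OF ne(2)]
    by (auto simp: r_def s_def dest: in_set_butlastD)
  have carr: "set r \<subseteq> carrier G" "set s \<subseteq> carrier G" "last v' \<in> carrier G" "last w' \<in> carrier G"
    "set p \<subseteq> carrier G" "set v' \<subseteq> carrier G" "set w' \<subseteq> carrier G"
    using rs vw(1,2) suf assms(1,2) by auto
  have "word_product G v' = word_product G w'"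
    using vw(4) suf carr word_product_append word_product_closed by (metis right_cancel)
  then have "word_product G (r @ [last v']) = word_product G (s @ [last w'])"
    using v' w' by simp
  then have eq: "word_product G r \<otimes> last v' = word_product G s \<otimes> last w'"
    using word_product_append[of r "[last v']"] word_product_append[of s "[last w']"] carr
      by simp
  \<comment> \<open>Cancelling \<open>f\<close> on the right leaves
    \<open>word_product G r = word_product G s \<otimes> h\<close>. Both words act on
    \<open>A\<close> through their common length, so injectivity gives the claim.\<close>
  have key: "h x = x" if "word_product G r \<otimes> f = word_product G s \<otimes> (h \<otimes> f)"
    "set r \<subseteq> {f, h \<otimes> f}" "set s \<subseteq> {f, h \<otimes> f}" "length r = length s" for r s
  proof -
    have c: "word_product G r \<in> carrier G" "word_product G s \<in> carrier G"
      using that assms(1,2) by (auto intro!: word_product_closed)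
    then have "word_product G r = word_product G s \<otimes> h"
      using that(1) assms(1,2) by (metis m_assoc m_closed right_cancel)
    then have "word_product G r x = word_product G s (h x)" using mult_apply c assms by auto
    moreover have "word_product G r x = word_product G s x" using act that assms(7) by simp
    ultimately show ?thesis using apply_inj c(2) apply_closed assms by (metis subsetD)
  qed
  show ?thesis
  proof (cases "last v' = f")
    case True
    then have "last w' = h \<otimes> f" using rs ne by auto
    then show ?thesis using key[of r s] True eq rs by simp
  next
    case False
    then have "last v' = h \<otimes> f" "last w' = f" using rs ne by auto
    then show ?thesis using key[of s r] eq rs by simp
  qed
qed

subsection \<open>Tame cylinders and hyperbolic points\<close>

definition tame :: "nat list \<Rightarrow> bool" where
  "tame u \<longleftrightarrow> (\<forall>g\<in>carrier G. \<exists>v\<in>W. aff g u v)"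

text \<open>Iterating \<open>f\<close> contracts \<open>C u\<close> to the point with address u w w
  w ..., which is \<open>z\<close>. The cylinder \<open>C u\<close> serves as the basin of
  \<open>z\<close>.\<close>

definition attracts :: "(real \<Rightarrow> real) \<Rightarrow> nat list \<Rightarrow> nat list \<Rightarrow> real \<Rightarrow> bool" where
  "attracts f u w z \<longleftrightarrow>
     f \<in> carrier G \<and> u \<in> W \<and> w \<in> W \<and> w \<noteq> [] \<and> z \<in> C u \<and> f z = z \<and> aff f u (u @ w)"

definition hyperbolic :: "real \<Rightarrow> bool" where
  "hyperbolic z \<longleftrightarrow> (\<exists>f u w. attracts f u w z)"

lemma attractsD:
  assumes "attracts f u w z"
  shows "f \<in> carrier G" "u \<in> W" "w \<in> W" "w \<noteq> []" "z \<in> C u" "z \<in> K" "f z = z" "aff f u (u @ w)"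
    "\<And>k. u @ repeat w k \<in> W" "\<And>k. f [^] (k::nat) \<in> carrier G"
    "\<And>k. aff (f [^] k) u (u @ repeat w k)"
proof -
  show f: "f \<in> carrier G" "u \<in> W" "w \<in> W" "w \<noteq> []" "z \<in> C u" "f z = z" "aff f u (u @ w)"
    using assms unfolding attracts_def by blast+
  then show "z \<in> K" using cylinder_subset by blast
  show "u @ repeat w k \<in> W" "f [^] k \<in> carrier G" "aff (f [^] k) u (u @ repeat w k)" for k
    using f repeat_in_lists[OF f(3)] aff_pow
      by (simp_all only: append_in_lists_conv nat_pow_closed)
qed

lemma length_append_repeat: "w \<noteq> [] \<Longrightarrow> k \<le> length (u @ repeat w k)"
  by (cases "length w") (auto simp: length_repeat)

lemma repeat_cylinder_antimono:
  assumes "w \<in> W" "j \<le> k" shows "C (u @ repeat w k) \<subseteq> C (u @ repeat w j)"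
proof -
  obtain i where "k = j + i" using assms(2) by (auto simp: le_iff_add)
  then have "u @ repeat w k = (u @ repeat w j) @ repeat w i" by (simp add: replicate_add)
  then show ?thesis
    using cylinder_append[OF repeat_in_lists[OF assms(1), of i], of "u @ repeat w j"]
      by (simp only:)
qed

lemma repeat_cylinder_unique:
  assumes "w \<noteq> []" "\<And>k. x \<in> C (u @ repeat w k)" "\<And>k. y \<in> C (u @ repeat w k)"
  shows "x = y"
proof (rule ccontr)
  assume "x \<noteq> y"
  then obtain N where "\<And>v. x \<in> C v \<Longrightarrow> y \<in> C v \<Longrightarrow> length v < N" using points_separated by meson
  from this[OF assms(2,3), of N] length_append_repeat[OF assms(1), of N u] show False by simp
qed

lemma attracts_mem: "attracts f u w z \<Longrightarrow> z \<in> C (u @ repeat w k)"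
  using aff_image[OF attractsD(11)] pow_fixed[of f z k] attractsD by (metis image_eqI)

lemma attracts_leave:
  assumes "attracts f u w z" "x \<noteq> z"
  obtains k where "k > 0" "x \<notin> C (u @ repeat w k)"
proof -
  obtain k where "x \<notin> C (u @ repeat w k)"
    using repeat_cylinder_unique[of w x u z] attractsD(4) attracts_mem assms by blast
  then have "x \<notin> C (u @ repeat w (Suc k))"
    using repeat_cylinder_antimono[OF attractsD(3)[OF assms(1)], of k "Suc k" u] by auto
  then show thesis using that[of "Suc k"] by blast
qed

text \<open>The cylinders of the words \<open>u @ repeat w m\<close> form a neighbourhood base of
  \<open>z\<close>; the length of \<open>r\<close> is a sufficient exponent.\<close>

lemma attracts_inside:
  assumes "attracts f u w z" "r \<in> W" "z \<in> C r"
  shows "\<exists>m. \<exists>s\<in>W. u @ repeat w m = r @ s"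
  using cylinders_meet[OF assms(2) attractsD(9)[OF assms(1)] assms(3) attracts_mem[OF assms(1)]
      length_append_repeat[OF attractsD(4)[OF assms(1)]]] by blast

lemma attracts_local:
  assumes "attracts f u w z" "h \<in> carrier G"
  obtains m v where "v \<in> W" "k \<le> length v" "aff h (u @ repeat w m) v" "h z \<in> C v"
proof -
  have z: "z \<in> K" using attractsD(6)[OF assms(1)] .
  then have "h z \<in> C []" using apply_closed assms by simp
  then obtain r v where rv: "r \<in> W" "v \<in> W" "z \<in> C r" "aff h r v" "k \<le> length v"
    using locally_aff[OF assms(2) z lists.Nil] by metis
  obtain m s where s: "s \<in> W" "u @ repeat w m = r @ s"
    using attracts_inside[OF assms(1) rv(1,3)] by blast
  have a: "aff h (u @ repeat w m) (v @ s)" using aff_append rv s by simp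
  then have "h z \<in> C (v @ s)" using aff_image[OF a] attracts_mem[OF assms(1)] by blast
  then show thesis using that[of "v @ s" m] rv s a by auto
qed

lemma cylinders_disjoint:
  assumes "u \<in> W" "v \<in> W" "length u \<le> length v" "x \<in> C v" "x \<notin> C u"
  shows "C u \<inter> C v = {}"
  using cylinder_mono[OF assms(1,2) _ _ assms(3)] assms(4,5) by blast

lemma ping_pong_words:
  assumes "a \<in> carrier G" "b \<in> carrier G" "u \<in> W" "v \<in> W" "w \<in> W" "aff a u (u @ v)" "aff b u (u @ w)"
    "C (u @ v) \<inter> C (u @ w) = {}"
  shows False
proof (rule ping_pong[of a b "C u"])
  show "C u \<noteq> {}" using zero_one_mem by (auto simp: cylinder_def)
qed (use assms cylinder_subset aff_image cylinder_append in auto)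

section \<open>Rigidity of tame cylinders\<close>

text \<open>The inverse of the k-th power of \<open>f\<close> shortens \<open>u @ repeat w k\<close>
  to \<open>u\<close>. By tameness it also replaces \<open>u\<close> by some \<open>v\<close>, so
  \<open>u = v @ repeat w k\<close>, which is impossible once k exceeds the length of
  \<open>u\<close>.\<close>

lemma no_expansion:
  assumes "f \<in> carrier G" "u \<in> W" "w \<in> W" "tame u" "aff f u (u @ w)"
  shows "w = []"
proof (rule ccontr)
  assume "w \<noteq> []"
  define k where "k = Suc (length u)"
  define g where "g = inv (f [^] k)"
  have fk: "f [^] k \<in> carrier G" "aff (f [^] k) u (u @ repeat w k)" using aff_pow assms by auto
  then obtain v where v: "v \<in> W" "aff g u v" using assms unfolding tame_def g_def by blast
  have r: "repeat w k \<in> W" by (rule repeat_in_lists[OF assms(3)])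
  have "aff g (u @ repeat w k) u" using aff_inv fk assms unfolding g_def by blast
  moreover have "aff g (u @ repeat w k) (v @ repeat w k)" using aff_append v r by blast
  ultimately have "u = v @ repeat w k" using aff_unique[of u "v @ repeat w k"] v r assms by simp
  then have "k \<le> length u" using length_append_repeat[OF \<open>w \<noteq> []\<close>, of k v] by simp
  then show False by (simp add: k_def)
qed

lemma tame_append: "tame u \<Longrightarrow> s \<in> W \<Longrightarrow> tame (u @ s)"
  unfolding tame_def using aff_append by (metis append_in_lists_conv)

text \<open>The cylinder \<open>C u\<close> and its image share \<open>g x\<close>, so they are
  nested. A proper nesting would make \<open>g\<close> or its inverse replace \<open>u\<close> by a
  longer \<open>u @ w\<close>, against \<open>no_expansion\<close>.\<close>

lemma tame_return:
  assumes "u \<in> W" "tame u" "g \<in> carrier G" "x \<in> C u" "g x \<in> C u" "y \<in> C u"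
  shows "g y = y"
proof -
  obtain v where v: "v \<in> W" "aff g u v" using assms unfolding tame_def by blast
  then have gx: "g x \<in> C v" using aff_image assms by blast
  show ?thesis
  proof (cases "length u \<le> length v")
    case True
    then obtain w where "w \<in> W" "v = u @ w" using cylinders_meet gx assms v by blast
    then have "v = u" using no_expansion assms v by auto
    then show ?thesis using aff_id v assms by blast
  next
    case False
    then obtain w
      where w: "w \<in> W" "u = v @ w" using cylinders_meet[of v u "g x"] gx assms v by auto
    have "aff (inv g) u (u @ w)"
      using aff_append[OF aff_inv[OF assms(3,1) v(2)] w(1)] w(2) by simp
    then have "w = []" using no_expansion[of "inv g" u w] assms w by simp
    then show ?thesis using w False by simp
  qed
qed

text \<open>A small cylinder of the attracting base at \<open>z\<close> would be tame, yet
  \<open>f\<close> lengthens its word by \<open>w\<close>.\<close>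

lemma hyperbolic_not_tame:
  assumes "hyperbolic z" "u \<in> W" "z \<in> C u" "tame u"
  shows False
proof -
  obtain f v w where a: "attracts f v w z" using assms hyperbolic_def by blast
  obtain m s where s: "s \<in> W" "v @ repeat w m = u @ s"
    using attracts_inside[OF a assms(2,3)] by blast
  have "aff f (v @ repeat w m) ((v @ repeat w m) @ w)"
    using aff_repeat[of w f v m] attractsD[OF a] repeat_commute[of m w] by simp
  then have "w = []"
    using no_expansion[of f "u @ s" w] tame_append assms s attractsD[OF a] by simp
  then show False using attractsD(4)[OF a] by simp
qed

section \<open>Every point is tame or hyperbolic\<close>

text \<open>Generators and their inverses replace every prefix of length at least N. If all prefixes
  reachable from \<open>u\<close> were that long, one could apply generators forever, and
  \<open>u\<close> would be tame.\<close>

lemma not_tame_expands: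
  "\<exists>N. \<forall>u\<in>W. \<not> tame u \<longrightarrow> (\<exists>g\<in>carrier G. \<exists>v\<in>W. length v < N \<and> aff g u v)"
proof -
  obtain S where S: "finite S" "S \<subseteq> carrier G" "generate G S = carrier G" using fg by blast
  define T where "T = S \<union> (\<lambda>s. inv s) ` S"
  have T: "finite T" "T \<subseteq> carrier G" using S by (auto simp: T_def)
  then have "\<forall>s\<in>T. \<exists>N. \<forall>u\<in>W. N \<le> length u \<longrightarrow> (\<exists>v\<in>W. aff s u v)"
    using uniformly_affine by blast
  then obtain M where M: "\<And>s u. s \<in> T \<Longrightarrow> u \<in> W \<Longrightarrow> M s \<le> length u \<Longrightarrow> \<exists>v\<in>W. aff s u v"
    by metis
  define N where "N = sum M T"
  have N: "\<exists>v\<in>W. aff s u v" if "s \<in> T" "u \<in> W" "N \<le> length u" for s u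
    using M[OF that(1,2)] that(3) member_le_sum[OF that(1), of M] T by (simp add: N_def)
  have "\<exists>g\<in>carrier G. \<exists>v\<in>W. length v < N \<and> aff g u v" if u: "u \<in> W" "\<not> tame u" for u
  proof (rule ccontr)
    assume no: "\<not> ?thesis"
    \<comment> \<open>The claim covers all prefixes reachable from \<open>u\<close>, so that for a
      product the prefix produced by the right factor is again admissible for the left one.\<close>
    have step: "\<exists>v'\<in>W. aff h v v'" if "h \<in> generate G S" "v \<in> W" "\<exists>g\<in>carrier G. aff g u v" for h v
      using that
    proof (induction arbitrary: v rule: generate.induct)
      case one
      then show ?case using aff_one by blast
    next
      case (incl h)
      then have "N \<le> length v" using no by (meson not_le)
      then show ?case using N incl by (simp add: T_def)
    next
      case (inv h)
      then have "N \<le> length v" using no by (meson not_le)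
      then show ?case using N inv by (simp add: T_def)
    next
      case (eng h1 h2)
      have c: "h1 \<in> carrier G" "h2 \<in> carrier G" using eng.hyps S by auto
      obtain v' where v': "v' \<in> W" "aff h2 v v'" using eng.IH(2) eng.prems by blast
      obtain g where "g \<in> carrier G" "aff g u v" using eng.prems by blast
      then have "aff (h2 \<otimes> g) u v'" "h2 \<otimes> g \<in> carrier G" using aff_mult c u(1) v' by auto
      then obtain v'' where "v'' \<in> W" "aff h1 v' v''" using eng.IH(1)[OF v'(1)] by blast
      then show ?case using aff_mult[OF c eng.prems(1) v'(2)] by blast
    qed
    have "tame u" unfolding tame_def
      using step[OF _ u(1)] aff_one[OF u(1)] S(3) by blast
    then show False using u by simp
  qed
  then show ?thesis by blast
qed

text \<open>If no cylinder at \<open>x\<close> is tame, the ones of depth D can all be blown up to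
  words of bounded length, of which one recurs for infinitely many D. Comparing two such blow-ups
  gives elements contracting a fixed cylinder around \<open>x\<close> into arbitrarily small ones
  around \<open>x\<close>; one of them has \<open>x\<close> as its fixed point.\<close>

lemma tame_or_hyperbolic:
  assumes "x \<in> K"
  shows "(\<exists>u\<in>W. x \<in> C u \<and> tame u) \<or> hyperbolic x"
proof (cases "\<exists>u\<in>W. x \<in> C u \<and> tame u")
  case False
  obtain N where N: "\<And>u. u \<in> W \<Longrightarrow> \<not> tame u \<Longrightarrow> \<exists>g\<in>carrier G. \<exists>v\<in>W. length v < N \<and> aff g u v"
    using not_tame_expands by meson
  have "\<exists>p. p \<in> W \<and> length p = D \<and> x \<in> C p" for D using in_some_cylinder assms by blast
  then obtain p where p: "\<And>D. p D \<in> W \<and> length (p D) = D \<and> x \<in> C (p D)" by metis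
  have "\<exists>g v. g \<in> carrier G \<and> v \<in> W \<and> length v < N \<and> aff g (p D) v" for D
  proof -
    have "\<not> tame (p D)" using p False by blast
    then show ?thesis using N[of "p D"] p by blast
  qed
  then obtain g v
    where gv: "\<And>D. g D \<in> carrier G \<and> v D \<in> W \<and> length (v D) < N \<and> aff (g D) (p D) (v D)"
    by metis
  have "finite (range v)"
    by (rule finite_subset[OF _ finite_words_less[of N]]) (use gv in auto)
  then obtain D0 where D0: "infinite {D. v D = v D0}"
    using pigeonhole_infinite[of UNIV v] by auto
  \<comment> \<open>The witness first blows \<open>p D0\<close> up to the recurring word and then
    contracts that word to the deep \<open>p E\<close>.\<close>
  have return: "\<exists>f w. f \<in> carrier G \<and> w \<in> W \<and> D \<le> length w \<and> x \<in> C (p D0 @ w) \<and> aff f (p D0) (p D0 @ w)" for D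
  proof -
    obtain E where E: "D0 + D \<le> E" "v E = v D0"
      using D0 unfolding infinite_nat_iff_unbounded_le by blast
    obtain w where w: "w \<in> W" "p E = p D0 @ w"
      using cylinders_meet[of "p D0" "p E" x] p[of D0] p[of E] E by auto
    have "aff (inv (g E)) (v D0) (p E)"
      using aff_inv[of "g E" "p E" "v E"] gv[of E] p[of E] E by simp
    then have "aff (inv (g E) \<otimes> g D0) (p D0) (p E)"
      using aff_mult[of "inv (g E)" "g D0" "p D0" "v D0" "p E"] gv[of E] gv[of D0] p[of D0]
        by simp
    moreover have "D \<le> length w" using p[of E] p[of D0] w(2) E(1) by simp
    ultimately show ?thesis
      using w gv p[of E] by (intro exI[of _ "inv (g E) \<otimes> g D0"] exI[of _ w]) auto
  qed
  define u where "u = p D0"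
  have u: "u \<in> W" "x \<in> C u" using p by (auto simp: u_def)
  obtain f w where f: "f \<in> carrier G" "w \<in> W" "1 \<le> length w" "aff f u (u @ w)"
    using return[of 1] unfolding u_def by blast
  \<comment> \<open>If \<open>x\<close> escaped, a return to a deep enough cylinder around
    \<open>x\<close> would have image disjoint from that of the k-th power of \<open>f\<close>, and
    the two elements would play ping-pong.\<close>
  have stay: "x \<in> C (u @ repeat w k)" for k
  proof (rule ccontr)
    assume out: "x \<notin> C (u @ repeat w k)"
    obtain h s where h: "h \<in> carrier G" "s \<in> W" "length (repeat w k) \<le> length s" "x \<in> C (u @ s)" "aff h u (u @ s)"
      using return unfolding u_def by blast
    have r: "repeat w k \<in> W" by (rule repeat_in_lists[OF f(2)])
    have "C (u @ repeat w k) \<inter> C (u @ s) = {}"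
      by (rule cylinders_disjoint[OF _ _ _ h(4) out]) (use u h r in auto)
    then show False
      using ping_pong_words[of "f [^] k" h u "repeat w k" s] aff_pow f h u r by simp
  qed
  have "f x \<in> C (u @ repeat w k)" for k
  proof -
    have "f x \<in> C (u @ repeat w (Suc k))"
      using aff_image[OF aff_repeat[OF f(2,4)]] stay by blast
    then show ?thesis using repeat_cylinder_antimono[OF f(2), of k "Suc k" u] by auto
  qed
  then have "f x = x" by (rule repeat_cylinder_unique[rotated]) (use stay f(3) in auto)
  then have "attracts f u w x" unfolding attracts_def using f u by auto
  then show ?thesis by (auto simp: hyperbolic_def)
qed simp

section \<open>Isolation in the orbit and rigidity on the basin\<close>

text \<open>If \<open>h\<close> moved \<open>z\<close> inside the basin, then \<open>h\<close> after
  a high power of \<open>f\<close> would map \<open>C u\<close> into a small cylinder around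
  \<open>h z\<close>, disjoint from the image of \<open>C u\<close> under another power of
  \<open>f\<close>: ping-pong.\<close>

lemma isolated_in_orbit:
  assumes "attracts f u w z" "h \<in> carrier G" "h z \<in> C u"
  shows "h z = z"
proof (rule ccontr)
  assume "h z \<noteq> z"
  then obtain k where k: "h z \<notin> C (u @ repeat w k)" using attracts_leave assms(1) by metis
  obtain m v where v: "v \<in> W" "length (u @ repeat w k) \<le> length v" "aff h (u @ repeat w m) v" "h z \<in> C v"
    using attracts_local[OF assms(1,2)] by metis
  note D = attractsD[OF assms(1)]
  obtain s where s: "s \<in> W" "v = u @ s"
    using cylinders_meet[OF D(2) v(1) assms(3) v(4)] v(2) by auto
  have "aff (h \<otimes> f [^] m) u (u @ s)"
    using aff_mult[OF assms(2) D(10) D(2) D(11) v(3)] s by simp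
  moreover have "C (u @ repeat w k) \<inter> C (u @ s) = {}"
    by (rule cylinders_disjoint[OF _ _ _ _ k]) (use D(9) v s in auto)
  ultimately show False
    using ping_pong_words[of "f [^] k" "h \<otimes> f [^] m" u "repeat w k" s] D assms(2) s(1) by auto
qed

text \<open>Triviality spreads outwards along the cylinders of \<open>u @ repeat w j\<close>:
  \<open>f\<close> maps each of them onto the next smaller one, so
  \<open>trivial_on_preimage\<close> applies.\<close>

lemma trivial_on_basin:
  assumes "attracts f u w z" "h \<in> carrier G" "r \<in> W" "z \<in> C r"
    and "\<And>x. x \<in> C r \<Longrightarrow> h x = x" and "x \<in> C u"
  shows "h x = x"
proof -
  note D = attractsD[OF assms(1)]
  obtain m s where s: "s \<in> W" "u @ repeat w m = r @ s"
    using attracts_inside[OF assms(1,3,4)] by blast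
  \<comment> \<open>Descending induction on the exponent, run over \<open>i\<close>; at
    \<open>i = m\<close> it reaches \<open>C u\<close>.\<close>
  have "\<forall>x\<in>C (u @ repeat w (m - i)). h x = x" for i
  proof (induction i)
    case 0
    then show ?case using s assms(5) cylinder_append by auto
  next
    case (Suc i)
    show ?case
    proof (cases "m \<le> i")
      case False
      define j where "j = m - Suc i"
      have j: "m - i = Suc j" using False by (simp add: j_def)
      have im: "f ` C (u @ repeat w j) = C (u @ repeat w (Suc j))"
        using aff_image[OF aff_repeat[OF D(3,8)]] .
      have "h x = x" if "x \<in> C (u @ repeat w j)" for x
      proof (rule trivial_on_preimage[OF D(1) assms(2) _ _ _ _ that])
        show "C (u @ repeat w j) \<subseteq> K" using cylinder_subset D(9) by blast
        show "f ` C (u @ repeat w j) \<subseteq> C (u @ repeat w j)"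
          using im repeat_cylinder_antimono[OF D(3), of j "Suc j" u] by simp
        show "h (f x) = f x" if "x \<in> C (u @ repeat w j)" for x
          using Suc im that unfolding j by blast
        \<comment> \<open>Different powers of \<open>f\<close> lengthen the prefix by different
          amounts, hence differ on this cylinder.\<close>
        fix k l :: nat assume eq: "\<And>x. x \<in> C (u @ repeat w j) \<Longrightarrow> (f [^] k) x = (f [^] l) x"
        have p: "aff (f [^] i) (u @ repeat w j) ((u @ repeat w i) @ repeat w j)" for i
          using aff_append[OF D(11) repeat_in_lists[OF D(3)], of i j]
          by (simp flip: concat_append replicate_add add: add.commute)
        have "aff (f [^] k) (u @ repeat w j) ((u @ repeat w l) @ repeat w j)"
          using p[of l] eq unfolding replaces_prefix_def by (auto simp: cylinder_def)
        then have "(u @ repeat w k) @ repeat w j = (u @ repeat w l) @ repeat w j"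
          by (intro aff_unique[OF _ _ p[of k]]) (use D(2) repeat_in_lists[OF D(3)] in simp_all)
        then have "length (repeat w k) = length (repeat w l)" by simp
        then show "k = l" using D(4) by (simp add: length_repeat)
      qed
      then show ?thesis by (simp add: j_def)
    qed (use Suc in simp)
  qed
  from this[of m] show ?thesis using assms(6) by simp
qed

text \<open>Near \<open>z\<close> the element \<open>g\<close> replaces
  \<open>u @ repeat w m\<close> by some \<open>v\<close>, so the conjugate replaces \<open>v\<close>
  by \<open>v @ w\<close>.\<close>

lemma attracts_conjugate:
  assumes "attracts f u w z" "g \<in> carrier G"
  shows "\<exists>v. attracts (g \<otimes> f \<otimes> inv g) v w (g z)"
proof -
  note D = attractsD[OF assms(1)]
  obtain m v where v: "v \<in> W" "aff g (u @ repeat w m) v" "g z \<in> C v"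
    using attracts_local[OF assms(1,2)] by metis
  have "aff f (u @ repeat w m) ((u @ repeat w m) @ w)"
    using aff_repeat[of w f u m] D repeat_commute[of m w] by simp
  moreover have "aff g ((u @ repeat w m) @ w) (v @ w)" using aff_append v D by blast
  ultimately have "aff (g \<otimes> f) (u @ repeat w m) (v @ w)" using aff_mult D assms(2) by blast
  moreover have "aff (inv g) v (u @ repeat w m)" using aff_inv v assms(2) D(9) by blast
  ultimately have "aff (g \<otimes> f \<otimes> inv g) v (v @ w)" using aff_mult D(1) assms(2) v(1) by simp
  moreover have "(g \<otimes> f \<otimes> inv g) (g z) = g z"
    using D assms(2) apply_closed by (simp add: mult_apply inv_apply)
  ultimately show ?thesis unfolding attracts_def using D assms(2) v by auto
qed

lemma hyperbolic_image: "hyperbolic z \<Longrightarrow> g \<in> carrier G \<Longrightarrow> hyperbolic (g z)"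
  using attracts_conjugate unfolding hyperbolic_def by blast

subsection \<open>Finiteness of the hyperbolic set\<close>

abbreviation orb :: "real \<Rightarrow> real set" where
  "orb z \<equiv> (\<lambda>g. g z) ` carrier G"

lemma apply_ext:
  assumes "f \<in> carrier G" "g \<in> carrier G" "\<And>x. x \<in> K \<Longrightarrow> f x = g x"
  shows "f = g"
proof -
  have "inv g \<otimes> f = \<one>"
    by (rule faithful) (use assms in \<open>auto simp: mult_apply inv_apply\<close>)
  then show ?thesis using assms by (metis inv_equality inv_inv inv_closed)
qed

lemma locally_into:
  assumes "g \<in> carrier G" "x \<in> K" "u \<in> W" "g x \<in> C u"
  shows "\<exists>r\<in>W. x \<in> C r \<and> g ` C r \<subseteq> C u"
proof -
  obtain r v where "r \<in> W" "x \<in> C r" "aff g r v" "C v \<subseteq> C u"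
    using locally_aff[OF assms, of 0] by metis
  then show ?thesis using aff_image[of g r v] by auto
qed

lemma compact_minus_cylinders:
  assumes "compact L" "L \<subseteq> K" "R \<subseteq> W"
  shows "compact (L - (\<Union>r\<in>R. C r))"
proof -
  have "\<forall>r\<in>R. \<exists>T. open T \<and> C r = K \<inter> T" using cylinder_open assms(3) by (metis subsetD)
  then obtain T where T: "\<And>r. r \<in> R \<Longrightarrow> open (T r)" "\<And>r. r \<in> R \<Longrightarrow> C r = K \<inter> T r" by metis
  have "L - (\<Union>r\<in>R. C r) = L - (\<Union>r\<in>R. T r)" using T(2) assms(2) by auto
  moreover have "open (\<Union>r\<in>R. T r)" using T(1) by (rule open_UN[rule_format])
  ultimately show ?thesis using compact_diff[OF assms(1)] by simp
qed

lemma cylinder_cover: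
  assumes "compact L" "L \<subseteq> K" "\<And>x. x \<in> L \<Longrightarrow> u x \<in> W \<and> x \<in> C (u x)"
  shows "\<exists>F\<subseteq>L. finite F \<and> L \<subseteq> (\<Union>x\<in>F. C (u x))"
proof -
  have "\<forall>x\<in>L. \<exists>T. open T \<and> C (u x) = K \<inter> T" using cylinder_open assms(3) by metis
  then obtain T where T: "\<And>x. x \<in> L \<Longrightarrow> open (T x)" "\<And>x. x \<in> L \<Longrightarrow> C (u x) = K \<inter> T x" by metis
  have "L \<subseteq> (\<Union>x\<in>L. T x)" using T(2) assms(3) by blast
  then obtain F where "F \<subseteq> L" "finite F" "L \<subseteq> (\<Union>x\<in>F. T x)"
    using compactE_image[OF assms(1), of L T] T(1) by metis
  then show ?thesis using T(2) assms(2) by (intro exI[of _ F]) blast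
qed

lemma hyperbolic_in: "hyperbolic z \<Longrightarrow> z \<in> K"
  using attractsD(6) by (auto simp: hyperbolic_def)

text \<open>In a minimal closed invariant \<open>T\<close>, the points whose orbit misses the basin
  of \<open>z\<close> form a closed invariant proper subset, which is therefore empty. By
  compactness finitely many elements suffice to move all of \<open>T\<close> into that
  basin.\<close>

lemma exists_finite_orbit:
  assumes "compact L" "L \<noteq> {}" "\<And>z. z \<in> L \<Longrightarrow> hyperbolic z"
    and "\<And>g. g \<in> carrier G \<Longrightarrow> g ` L \<subseteq> L"
  shows "\<exists>z\<in>L. finite (orb z)"
proof -
  obtain T where T: "T \<subseteq> L" "compact T" "T \<noteq> {}" "\<forall>g\<in>carrier G. g ` T \<subseteq> T"
    and min: "\<And>U. \<lbrakk>U \<subseteq> L; closed U; U \<noteq> {}; \<forall>g\<in>carrier G. g ` U \<subseteq> U\<rbrakk> \<Longrightarrow> \<not> U \<subset> T"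
  proof (rule Brouwer_reduction_theorem[of L "\<lambda>T. \<forall>g\<in>carrier G. g ` T \<subseteq> T"])
    fix F :: "nat \<Rightarrow> real set" assume "\<And>n. \<forall>g\<in>carrier G. g ` F n \<subseteq> F n"
    then show "\<forall>g\<in>carrier G. g ` \<Inter> (range F) \<subseteq> \<Inter> (range F)" by blast
  qed (use assms in auto)
  have TK: "T \<subseteq> K" using T(1) assms(3) hyperbolic_in by blast
  obtain z where z: "z \<in> T" using T(3) by blast
  then obtain f u w where a: "attracts f u w z" using assms(3) T(1) hyperbolic_def by blast
  note D = attractsD[OF a]
  \<comment> \<open>The union of these cylinders is the relatively open set of points whose orbit
    meets \<open>C u\<close>.\<close>
  define R where "R = {r \<in> W. \<exists>g\<in>carrier G. g ` C r \<subseteq> C u}"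
  define U where "U = T - (\<Union>r\<in>R. C r)"
  have R: "(\<exists>r\<in>R. x \<in> C r) \<longleftrightarrow> (\<exists>g\<in>carrier G. g x \<in> C u)" if "x \<in> K" for x
    using locally_into[OF _ that D(2)] unfolding R_def by blast
  have "compact U"
    unfolding U_def by (rule compact_minus_cylinders) (use T TK in \<open>auto simp: R_def\<close>)
  moreover have "\<forall>g\<in>carrier G. g ` U \<subseteq> U"
  proof (intro ballI subsetI)
    fix h y assume h: "h \<in> carrier G" and "y \<in> h ` U"
    then obtain x where x: "x \<in> T" "\<not> (\<exists>r\<in>R. x \<in> C r)" "y = h x" by (auto simp: U_def)
    have "y \<in> T" using x T(4) h by blast
    moreover have "\<not> (\<exists>g\<in>carrier G. g y \<in> C u)"
    proof
      assume "\<exists>g\<in>carrier G. g y \<in> C u"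
      then obtain g where "g \<in> carrier G" "g (h x) \<in> C u" using x(3) by blast
      then have "(g \<otimes> h) x \<in> C u" "g \<otimes> h \<in> carrier G" using mult_apply h x(1) TK by auto
      then show False using R[of x] x TK by blast
    qed
    ultimately show "y \<in> U" using R[of y] TK unfolding U_def by blast
  qed
  moreover have "z \<notin> U"
  proof -
    have "\<one> z \<in> C u" using D one_apply by simp
    then show ?thesis using R[OF D(6)] unfolding U_def by blast
  qed
  moreover have "U \<subseteq> T" by (auto simp: U_def)
  ultimately have "U = {}" using min[of U] z T(1) compact_imp_closed by blast
  then have cov: "\<exists>r\<in>R. x \<in> C r" if "x \<in> T" for x using that by (auto simp: U_def)
  then obtain r where r: "\<And>x. x \<in> T \<Longrightarrow> r x \<in> R \<and> x \<in> C (r x)" by metis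
  then have "\<And>x. x \<in> T \<Longrightarrow> \<exists>g\<in>carrier G. g ` C (r x) \<subseteq> C u" by (auto simp: R_def)
  then obtain g where g: "\<And>x. x \<in> T \<Longrightarrow> g x \<in> carrier G \<and> g x ` C (r x) \<subseteq> C u" by metis
  obtain F where F: "F \<subseteq> T" "finite F" "T \<subseteq> (\<Union>x\<in>F. C (r x))"
    using cylinder_cover[OF T(2) TK, of r] r by (auto simp: R_def)
  \<comment> \<open>An orbit point moved into the basin lands on \<open>z\<close> itself by
    \<open>isolated_in_orbit\<close>, so it is one of finitely many preimages of
    \<open>z\<close>.\<close>
  have "orb z \<subseteq> (\<lambda>x. (inv (g x)) z) ` F"
  proof
    fix y assume "y \<in> orb z"
    then obtain h where h: "h \<in> carrier G" "y = h z" by blast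
    then have "y \<in> T" using T(4) z by blast
    then obtain x where x: "x \<in> F" "y \<in> C (r x)" using F by blast
    then have gx: "g x \<in> carrier G" "g x y \<in> C u" using g F by blast+
    have hg: "(g x \<otimes> h) z = g x y" using mult_apply gx h D(6) by simp
    then have "g x y = z" using isolated_in_orbit[OF a, of "g x \<otimes> h"] gx h by simp
    then have "y = (inv (g x)) z" using inv_apply(1)[OF gx(1), of y] \<open>y \<in> T\<close> TK by auto
    then show "y \<in> (\<lambda>x. (inv (g x)) z) ` F" using x by blast
  qed
  then have "finite (orb z)" using F(2) finite_surj by blast
  then show ?thesis using z T(1) by blast
qed

section \<open>Germs at a fixed point\<close>

text \<open>Prefix replacement is affine, so near a fixed point only a multiplier remains, a power
  of 2n - 1.\<close>

lemma affine_at_fixed: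
  assumes "a \<in> carrier G" "z \<in> K" "a z = z"
  shows "\<exists>c. \<exists>r\<in>W. z \<in> C r \<and> (\<forall>x\<in>C r. a x = z + c * (x - z))"
proof -
  have "a z \<in> C []" using assms by simp
  then obtain r v where r: "r \<in> W" "z \<in> C r" "aff a r v"
    using locally_aff[OF assms(1,2) lists.Nil] by metis
  define q where "q = 2 * real n - 1"
  have q: "q \<noteq> 0" using scale_ge by (simp add: q_def)
  obtain s where s: "s \<in> K" "z = \<phi> r s" using r by (auto simp: cylinder_def)
  have "a x = z + q ^ length r / q ^ length v * (x - z)" if x: "x \<in> C r" for x
  proof -
    obtain t where t: "t \<in> K" "x = \<phi> r t" using x by (auto simp: cylinder_def)
    have "a x = \<phi> v t" "z = \<phi> v s" using r(3) s t assms(3) by (auto simp: replaces_prefix_def)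
    then have 1: "a x - z = (t - s) / q ^ length v"
      using cantor_map_eq[of n v t] cantor_map_eq[of n v s]
        by (simp add: q_def diff_divide_distrib)
    have "x - z = (t - s) / q ^ length r"
      using s t cantor_map_eq[of n r t] cantor_map_eq[of n r s]
        by (simp add: q_def diff_divide_distrib)
    then have "a x - z = q ^ length r / q ^ length v * (x - z)" using 1 q by simp
    then show ?thesis by simp
  qed
  then show ?thesis using r by blast
qed

text \<open>Affine maps with a common fixed point commute. The cylinder is shrunk until the images
  under \<open>a\<close> and \<open>b\<close> stay where the formulas hold.\<close>

lemma commute_near_fixed:
  assumes "a \<in> carrier G" "b \<in> carrier G" "z \<in> K" "a z = z" "b z = z"
  shows "\<exists>r\<in>W. z \<in> C r \<and> (\<forall>x\<in>C r. a (b x) = b (a x))"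
proof -
  obtain c p where p: "p \<in> W" "z \<in> C p" "\<And>x. x \<in> C p \<Longrightarrow> a x = z + c * (x - z)"
    using affine_at_fixed assms(1,3,4) by metis
  obtain d q where q: "q \<in> W" "z \<in> C q" "\<And>x. x \<in> C q \<Longrightarrow> b x = z + d * (x - z)"
    using affine_at_fixed assms(2,3,5) by metis
  obtain p' where p': "p' \<in> W" "z \<in> C p'" "a ` C p' \<subseteq> C q"
    using locally_into[OF assms(1,3) q(1)] q(2) assms(4) by auto
  obtain q' where q': "q' \<in> W" "z \<in> C q'" "b ` C q' \<subseteq> C p"
    using locally_into[OF assms(2,3) p(1)] p(2) assms(5) by auto
  obtain r1 where r1: "r1 \<in> W" "z \<in> C r1" "C r1 \<subseteq> C p" "C r1 \<subseteq> C q"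
    using cylinder_refine[OF p(1) q(1) p(2) q(2)] by metis
  obtain r2 where r2: "r2 \<in> W" "z \<in> C r2" "C r2 \<subseteq> C p'" "C r2 \<subseteq> C q'"
    using cylinder_refine[OF p'(1) q'(1) p'(2) q'(2)] by metis
  obtain r where r: "r \<in> W" "z \<in> C r" "C r \<subseteq> C r1" "C r \<subseteq> C r2"
    using cylinder_refine[OF r1(1) r2(1) r1(2) r2(2)] by metis
  have "a (b x) = b (a x)" if "x \<in> C r" for x
  proof -
    have 1: "x \<in> C p" "x \<in> C q" "x \<in> C p'" "x \<in> C q'" using that r r1 r2 by blast+
    then have "a x \<in> C q" "b x \<in> C p" using p'(3) q'(3) by blast+
    then show ?thesis using p(3) q(3) 1 by simp
  qed
  then show ?thesis using r by blast
qed

text \<open>The commutator-like \<open>k\<close> is trivial near \<open>z\<close>, hence on the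
  whole basin by \<open>trivial_on_basin\<close>.\<close>

lemma commute_on_basin:
  assumes "attracts f u w z" "a \<in> carrier G" "b \<in> carrier G" "a z = z" "b z = z" "x \<in> C u"
  shows "a (b x) = b (a x)"
proof -
  define k where "k = inv (b \<otimes> a) \<otimes> (a \<otimes> b)"
  have k: "k \<in> carrier G" using assms by (simp add: k_def)
  have kx: "k y = (inv (b \<otimes> a)) (a (b y))" if "y \<in> K" for y
    using that assms(2,3) apply_closed by (simp add: k_def mult_apply)
  have ba: "(b \<otimes> a) y = b (a y)" if "y \<in> K" for y using that assms(2,3) mult_apply by simp
  obtain r where r: "r \<in> W" "z \<in> C r" "\<And>y. y \<in> C r \<Longrightarrow> a (b y) = b (a y)"
    using commute_near_fixed[OF assms(2,3) attractsD(6)[OF assms(1)] assms(4,5)] by blast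
  have "k y = y" if "y \<in> C r" for y
  proof -
    have "y \<in> K" using that r(1) cylinder_subset by blast
    then have "k y = (inv (b \<otimes> a)) ((b \<otimes> a) y)" using kx ba r(3)[OF that] by simp
    then show ?thesis using inv_apply(1) \<open>y \<in> K\<close> assms(2,3) by simp
  qed
  then have "k x = x" using trivial_on_basin[OF assms(1) k r(1,2) _ assms(6)] by blast
  have xK: "x \<in> K" using assms(6) attractsD(2)[OF assms(1)] cylinder_subset by blast
  have "(b \<otimes> a) (k x) = a (b x)"
    unfolding kx[OF xK] by (rule inv_apply(2)) (use assms(2,3) xK apply_closed in auto)
  then show ?thesis using \<open>k x = x\<close> ba xK by simp
qed

lemma attracts_pow:
  assumes "attracts f u w z" "0 < k"
  shows "attracts (f [^] (k::nat)) u (repeat w k) z"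
proof -
  note D = attractsD[OF assms(1)]
  have "length w \<noteq> 0" using D(4) by simp
  then have "length (repeat w k) \<noteq> 0" using assms(2) by (simp add: length_repeat)
  then have "repeat w k \<noteq> []" by force
  then show ?thesis unfolding attracts_def
    using D repeat_in_lists[OF D(3)] pow_fixed[of f z k] by simp
qed

lemma pow_fixes_finite_orbit:
  assumes "h \<in> carrier G" "z \<in> K" "finite (orb z)"
  shows "\<exists>k>0. (h [^] (k::nat)) z = z"
proof -
  have "finite (range (\<lambda>i::nat. (h [^] i) z))"
    by (rule finite_subset[OF _ assms(3)]) (use assms(1) in auto)
  then have "\<not> inj (\<lambda>i::nat. (h [^] i) z)" using range_inj_infinite by blast
  then obtain i j :: nat where "i \<noteq> j" "(h [^] i) z = (h [^] j) z" unfolding inj_on_def by blast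
  then have "\<exists>i j::nat. i < j \<and> (h [^] i) z = (h [^] j) z" by (metis linorder_neqE_nat)
  then obtain i j :: nat where ij: "i < j" "(h [^] i) z = (h [^] j) z" by blast
  have "h [^] j = h [^] i \<otimes> h [^] (j - i)"
    using nat_pow_mult[OF assms(1), of i "j - i"] ij(1) by simp
  then have "(h [^] i) z = (h [^] i) ((h [^] (j - i)) z)"
    using ij(2) mult_apply assms(1,2) by simp
  then have "z = (h [^] (j - i)) z"
    using apply_inj[of "h [^] i"] apply_closed assms(1,2) by simp
  then show ?thesis using ij(1) by (intro exI[of _ "j - i"]) auto
qed

text \<open>Since \<open>h\<close> commutes with \<open>f\<close> on the basin of \<open>z\<close>
  and fixes \<open>y\<close>, it fixes all images of \<open>y\<close> under powers of
  \<open>f\<close>, and these approach \<open>z\<close>. A second fixed point makes the affine germ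
  of \<open>h\<close> at \<open>z\<close> trivial, so \<open>h\<close> is trivial on the basin and
  near \<open>y\<close>, where it should contract.\<close>

lemma basin_isolated_fixed:
  assumes "attracts f u w z" "attracts h v s y" "h z = z" "y \<in> C u"
  shows "y = z"
proof (rule ccontr)
  assume "y \<noteq> z"
  note D = attractsD[OF assms(1)] and E = attractsD[OF assms(2)]
  have fy: "(f [^] i) y \<in> C u \<and> h ((f [^] i) y) = (f [^] i) y" for i :: nat
  proof (induction i)
    case 0
    then show ?case using one_apply E assms(4) by simp
  next
    case (Suc i)
    have "f ` C u \<subseteq> C u" using aff_image[OF D(8)] cylinder_append[OF D(3)] by blast
    moreover have "h (f ((f [^] i) y)) = f (h ((f [^] i) y))"
      using commute_on_basin[OF assms(1) E(1) D(1) assms(3) D(7)] Suc by blast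
    ultimately show ?case using Suc pow_add_apply[OF D(1) E(6), of i] by auto
  qed
  obtain c r where r: "r \<in> W" "z \<in> C r" "\<And>x. x \<in> C r \<Longrightarrow> h x = z + c * (x - z)"
    using affine_at_fixed[OF E(1) D(6) assms(3)] by blast
  obtain m t where mt: "t \<in> W" "u @ repeat w m = r @ t"
    using attracts_inside[OF assms(1) r(1,2)] by blast
  define x where "x = (f [^] m) y"
  have "x \<in> C (u @ repeat w m)" using aff_image[OF D(11)] assms(4) unfolding x_def by blast
  then have "x \<in> C r" using mt cylinder_append by auto
  then have "x = z + c * (x - z)" using r(3) fy unfolding x_def by metis
  moreover have "x \<noteq> z"
    using apply_inj[OF D(10) E(6) D(6), of m] pow_fixed[OF D(1,6,7), of m] \<open>y \<noteq> z\<close>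
      unfolding x_def by auto
  moreover have "x - z = c * (x - z)" using \<open>x = z + c * (x - z)\<close> by linarith
  ultimately have "c = 1" by (metis mult_cancel_right1 right_minus_eq)
  then have "h x = x" if "x \<in> C r" for x using r(3) that by simp
  then have hid: "h x = x" if "x \<in> C u" for x
    using trivial_on_basin[OF assms(1) E(1) r(1,2) _ that] by blast
  obtain m' t' where mt': "t' \<in> W" "v @ repeat s m' = u @ t'"
    using attracts_inside[OF assms(2) D(2) assms(4)] by blast
  let ?v = "v @ repeat s m'"
  have "\<forall>x\<in>C ?v. h x = x" using hid cylinder_append[OF mt'(1), of u] mt'(2) by auto
  then have "aff h ?v ?v" using aff_id E(9) by blast
  moreover have "aff h ?v (v @ repeat s (Suc m'))" by (rule aff_repeat[OF E(3,8)])
  ultimately have "?v = v @ repeat s (Suc m')" using aff_unique E(9) by blast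
  then have "length (repeat s m') = length (repeat s (Suc m'))" by simp
  then show False using E(4) by (simp add: length_repeat del: replicate.simps)
qed

text \<open>As the orbit of \<open>z\<close> is finite, a power of the element attracting to
  \<open>y\<close> fixes \<open>z\<close>, and powers still attract to \<open>y\<close>.\<close>

lemma basin_isolated:
  assumes "attracts f u w z" "finite (orb z)" "hyperbolic y" "y \<in> C u"
  shows "y = z"
proof -
  obtain h v s where a: "attracts h v s y" using assms(3) hyperbolic_def by blast
  obtain k :: nat where "k > 0" "(h [^] k) z = z"
    using pow_fixes_finite_orbit attractsD(1)[OF a] attractsD(6)[OF assms(1)] assms(2) by blast
  then show ?thesis using basin_isolated_fixed[OF assms(1) attracts_pow[OF a]] assms(4) by blast
qed

section \<open>Finite orbits and the number of hyperbolic points\<close>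

text \<open>Here \<open>L\<close> is the closure of the orbit of \<open>z\<close>. It consists of
  hyperbolic points, since a tame cylinder contains none. So \<open>L\<close> has a point
  \<open>x\<close> with finite orbit, and an orbit point of \<open>z\<close> inside the basin of
  \<open>x\<close> must equal \<open>x\<close>.\<close>

lemma hyperbolic_orbit_finite:
  assumes "hyperbolic z"
  shows "finite (orb z)"
proof -
  define R where "R = {r \<in> W. \<forall>g\<in>carrier G. g z \<notin> C r}"
  define L where "L = K - (\<Union>r\<in>R. C r)"
  have zK: "z \<in> K" using assms hyperbolic_in by blast
  have L: "x \<in> L \<longleftrightarrow> x \<in> K \<and> (\<forall>r\<in>W. x \<in> C r \<longrightarrow> (\<exists>g\<in>carrier G. g z \<in> C r))" for x
    unfolding L_def R_def by blast
  have Lh: "hyperbolic x" if xL: "x \<in> L" for x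
  proof (rule ccontr)
    assume "\<not> hyperbolic x"
    then obtain u
      where u: "u \<in> W" "x \<in> C u" "tame u" using tame_or_hyperbolic[of x] xL L[of x] by blast
    then obtain g where "g \<in> carrier G" "g z \<in> C u" using xL L[of x] by blast
    then show False using hyperbolic_not_tame[OF hyperbolic_image[OF assms]] u by blast
  qed
  have "\<exists>x\<in>L. finite (orb x)"
  proof (rule exists_finite_orbit)
    show "compact L" unfolding L_def
      by (rule compact_minus_cylinders[OF compact_cantor_set]) (auto simp: R_def)
    have "\<one> z = z" using one_apply zK by blast
    then have "z \<in> L" using L[of z] zK one_closed by metis
    then show "L \<noteq> {}" by blast
    fix h assume h: "h \<in> carrier G"
    show "h ` L \<subseteq> L"
    proof
      fix y assume "y \<in> h ` L"
      then obtain x where x: "x \<in> L" "y = h x" by blast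
      have xK: "x \<in> K" using x L[of x] by blast
      have "\<exists>g\<in>carrier G. g z \<in> C r" if r: "r \<in> W" "y \<in> C r" for r
      proof -
        obtain p where p: "p \<in> W" "x \<in> C p" "h ` C p \<subseteq> C r"
          using locally_into[OF h xK r(1)] r(2) x(2) by blast
        then obtain g where g: "g \<in> carrier G" "g z \<in> C p" using x(1) L[of x] by blast
        then have "(h \<otimes> g) z \<in> C r" using mult_apply h zK p(3) by auto
        then show ?thesis using g h by blast
      qed
      then show "y \<in> L" using L[of y] x(2) apply_closed[OF h xK] by blast
    qed
  qed (use Lh in blast)
  then obtain x where x: "x \<in> L" "finite (orb x)" by blast
  then obtain f u w where a: "attracts f u w x" using Lh hyperbolic_def by blast
  then obtain g
    where g: "g \<in> carrier G" "g z \<in> C u" using x(1) L[of x] attractsD(2,5)[OF a] by blast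
  then have gz: "g z = x"
    using basin_isolated[OF a x(2) hyperbolic_image[OF assms g(1)]] by blast
  have "h z \<in> orb x" if h: "h \<in> carrier G" for h
  proof -
    have "(h \<otimes> inv g) x = h z"
      using mult_apply[of h "inv g" x] inv_apply(1)[OF g(1) zK] gz h g(1) apply_closed[OF g(1) zK] by simp
    then show ?thesis using h g(1) by (intro image_eqI[of _ _ "h \<otimes> inv g"]) auto
  qed
  then show ?thesis using finite_subset[OF _ x(2), of "orb z"] by blast
qed

text \<open>The hyperbolic set is what tame cylinders leave of \<open>K\<close>, hence compact, and
  each basin contains only one of its points.\<close>

lemma finite_hyperbolic: "finite {z. hyperbolic z}"
proof -
  let ?H = "{z. hyperbolic z}"
  have "?H = K - (\<Union>u\<in>{u \<in> W. tame u}. C u)"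
    using hyperbolic_in hyperbolic_not_tame tame_or_hyperbolic by blast
  then have "compact ?H"
    using compact_minus_cylinders[OF compact_cantor_set subset_refl, of "{u \<in> W. tame u}"]
      by auto
  have "\<exists>u. \<exists>f w. attracts f u w z" if "z \<in> ?H" for z using that hyperbolic_def by blast
  then obtain u where u: "\<And>z. z \<in> ?H \<Longrightarrow> \<exists>f w. attracts f (u z) w z" by metis
  then have "\<And>z. z \<in> ?H \<Longrightarrow> u z \<in> W \<and> z \<in> C (u z)" using attractsD(2,5) by blast
  then obtain F where F: "F \<subseteq> ?H" "finite F" "?H \<subseteq> (\<Union>x\<in>F. C (u x))"
    using cylinder_cover[OF \<open>compact ?H\<close>, of u] hyperbolic_in by blast
  have "?H \<subseteq> F"
  proof
    fix y assume y: "y \<in> ?H"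
    then obtain z where z: "z \<in> F" "y \<in> C (u z)" using F(3) by blast
    then obtain f w where "attracts f (u z) w z" using u F(1) by blast
    then have "y = z" using basin_isolated hyperbolic_orbit_finite y z F(1) by blast
    then show "y \<in> F" using z by simp
  qed
  then show ?thesis using F(2) finite_subset by blast
qed

section \<open>Orbits of arbitrary points\<close>

text \<open>Finitely many tame cylinders and basins cover \<open>K\<close>. An orbit avoiding all
  basins lies in the tame ones, each of which it meets at most once by
  \<open>tame_return\<close>.\<close>

lemma infinite_orbit_meets_basin:
  assumes "x \<in> K" "infinite (orb x)"
  shows "\<exists>g\<in>carrier G. \<exists>f u w z. attracts f u w z \<and> g x \<in> C u"
proof (rule ccontr)
  assume no: "\<not> ?thesis"
  have "\<exists>u\<in>W. p \<in> C u \<and> (tame u \<or> (\<exists>f w. attracts f u w p))" if "p \<in> K" for p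
    using tame_or_hyperbolic[OF that] attractsD(2,5) unfolding hyperbolic_def by blast
  then obtain u
    where u: "\<And>p. p \<in> K \<Longrightarrow> u p \<in> W \<and> p \<in> C (u p) \<and> (tame (u p) \<or> (\<exists>f w. attracts f (u p) w p))"
    by metis
  obtain F where F: "F \<subseteq> K" "finite F" "K \<subseteq> (\<Union>p\<in>F. C (u p))"
    using cylinder_cover[OF compact_cantor_set subset_refl, of u] u by blast
  have fin: "finite (orb x \<inter> C (u p))" if p: "p \<in> F" for p
  proof (cases "orb x \<inter> C (u p) = {}")
    case False
    then obtain g where g: "g \<in> carrier G" "g x \<in> C (u p)" by blast
    then have t: "u p \<in> W" "tame (u p)" using no u[of p] F(1) p by blast+
    have "h x = g x" if h: "h \<in> carrier G" "h x \<in> C (u p)" for h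
    proof -
      have e: "(h \<otimes> inv g) (g x) = h x"
        using mult_apply[of h "inv g" "g x"] inv_apply(1)[OF g(1) assms(1)] h g apply_closed assms(1) by simp
      have "(h \<otimes> inv g) (g x) = g x"
        by (rule tame_return[OF t _ g(2) _ g(2)]) (use e h g in auto)
      then show ?thesis using e by simp
    qed
    then have "orb x \<inter> C (u p) \<subseteq> {g x}" by auto
    then show ?thesis using finite_subset by blast
  qed simp
  have "orb x \<subseteq> K" using apply_closed[OF _ assms(1)] by blast
  then have "orb x \<subseteq> (\<Union>p\<in>F. orb x \<inter> C (u p))" using F(3) by blast
  then have "finite (orb x)" by (rule finite_subset) (use fin F(2) in blast)
  then show False using assms(2) by simp
qed

text \<open>The local alternative for the final compactness argument: a finite orbit of a
  non-hyperbolic point gives the first case, a hyperbolic point or an infinite orbit the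
  second.\<close>

lemma tame_or_into_basin:
  assumes "x \<in> K"
  shows "\<exists>u\<in>W. x \<in> C u \<and> (tame u \<and> finite (orb x) \<or>
    (\<exists>g\<in>carrier G. \<exists>f v w z. attracts f v w z \<and> g ` C u \<subseteq> C v))"
proof (cases "finite (orb x) \<and> \<not> hyperbolic x")
  case True
  then show ?thesis using tame_or_hyperbolic[OF assms] by blast
next
  case False
  have "\<exists>g\<in>carrier G. \<exists>f u w z. attracts f u w z \<and> g x \<in> C u"
  proof (cases "hyperbolic x")
    case True
    then obtain f u w where "attracts f u w x" using hyperbolic_def by blast
    moreover have "\<one> x \<in> C u" if "attracts f u w x"
      using attractsD(5)[OF that] one_apply assms by simp
    ultimately show ?thesis using one_closed by blast
  next
    case False
    then show ?thesis
      using infinite_orbit_meets_basin assms \<open>\<not> (finite (orb x) \<and> \<not> hyperbolic x)\<close> by blast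
  qed
  then obtain g f v w z where g: "g \<in> carrier G" "attracts f v w z" "g x \<in> C v" by blast
  then show ?thesis using locally_into[OF g(1) assms attractsD(2)[OF g(2)] g(3)] by blast
qed

section \<open>Fixators of finite orbits and the abelian subgroup\<close>

lemma subgroup_fixator:
  assumes "Q \<subseteq> K" shows "subgroup {g \<in> carrier G. \<forall>q\<in>Q. g q = q} G"
proof
  fix g assume g: "g \<in> {g \<in> carrier G. \<forall>q\<in>Q. g q = q}"
  then have "(inv g) q = q" if "q \<in> Q" for q using inv_apply(1)[of g q] that assms by auto
  then show "inv g \<in> {g \<in> carrier G. \<forall>q\<in>Q. g q = q}" using g by auto
qed (use assms in \<open>auto simp: one_apply mult_apply subset_iff\<close>)

lemma finite_index_fixator:
  assumes "Q \<subseteq> K" "finite Q" "\<And>q. q \<in> Q \<Longrightarrow> finite (orb q)"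
  shows "finite (rcosets {g \<in> carrier G. \<forall>q\<in>Q. g q = q})"
proof -
  define A where "A = {g \<in> carrier G. \<forall>q\<in>Q. g q = q}"
  \<comment> \<open>The inverse matches right cosets: \<open>g \<otimes> inv h\<close> fixes
    \<open>q\<close> exactly when the inverses of \<open>g\<close> and \<open>h\<close> agree at
    \<open>q\<close>. Finite orbits leave finitely many values of \<open>\<rho>\<close>.\<close>
  define \<rho> where "\<rho> g = restrict (\<lambda>q. (inv g) q) Q" for g
  have A: "subgroup A G" unfolding A_def by (rule subgroup_fixator[OF assms(1)])
  have eq: "A #> g = A #> h" if gh: "g \<in> carrier G" "h \<in> carrier G" "\<rho> g = \<rho> h" for g h
  proof -
    have "(g \<otimes> inv h) q = q" if "q \<in> Q" for q
    proof -
      have "(inv g) q = (inv h) q" using fun_cong[OF gh(3), of q] that by (simp add: \<rho>_def)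
      then show ?thesis
        using mult_apply[of g "inv h" q] inv_apply(2)[of g q] gh that assms(1) by auto
    qed
    then have "g \<otimes> inv h \<in> A" using gh by (simp add: A_def)
    then have "A #> (g \<otimes> inv h) = A" using A by (simp add: coset_join2 subgroup.mem_carrier)
    then show ?thesis
      using coset_mult_assoc[of A "g \<otimes> inv h" h] gh A by (simp add: m_assoc subgroup.subset)
  qed
  have "\<rho> ` carrier G \<subseteq> (\<Pi>\<^sub>E q\<in>Q. orb q)" by (auto simp: \<rho>_def)
  then have fin: "finite (\<rho> ` carrier G)"
    using finite_subset finite_PiE[OF assms(2), of orb] assms(3) by blast
  have "rcosets A \<subseteq> (\<lambda>r. A #> (SOME g. g \<in> carrier G \<and> \<rho> g = r)) ` \<rho> ` carrier G"
  proof
    fix X assume "X \<in> rcosets A"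
    then obtain g where g: "g \<in> carrier G" "X = A #> g" by (auto simp: RCOSETS_def)
    let ?h = "SOME h. h \<in> carrier G \<and> \<rho> h = \<rho> g"
    have "?h \<in> carrier G \<and> \<rho> ?h = \<rho> g" by (rule someI[of _ g]) (use g in simp)
    then have "X = A #> ?h" using eq g by metis
    then show "X \<in> (\<lambda>r. A #> (SOME g. g \<in> carrier G \<and> \<rho> g = r)) ` \<rho> ` carrier G"
      using g by blast
  qed
  then have "finite (rcosets A)" using finite_subset finite_imageI[OF fin] by blast
  then show ?thesis by (simp add: A_def)
qed

text \<open>The fixator \<open>A\<close> of \<open>Q\<close> acts trivially on the covering
  cylinders that are tame around a point of finite orbit. The others are carried into a basin, where
  conjugates of elements of \<open>A\<close> commute.\<close>

lemma virtually_abelian_carrier: "virtually_abelian G"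
proof -
  obtain u where u: "\<And>x. x \<in> K \<Longrightarrow> u x \<in> W \<and> x \<in> C (u x) \<and> (tame (u x) \<and> finite (orb x) \<or>
    (\<exists>g\<in>carrier G. \<exists>f v w z. attracts f v w z \<and> g ` C (u x) \<subseteq> C v))"
    using tame_or_into_basin by metis
  obtain F where F: "F \<subseteq> K" "finite F" "K \<subseteq> (\<Union>x\<in>F. C (u x))"
    using cylinder_cover[OF compact_cantor_set subset_refl, of u] u by blast
  define Q where "Q = {z. hyperbolic z} \<union> {x \<in> F. finite (orb x)}"
  define A where "A = {g \<in> carrier G. \<forall>q\<in>Q. g q = q}"
  have Q: "Q \<subseteq> K" "finite Q" "\<And>q. q \<in> Q \<Longrightarrow> finite (orb q)"
    using hyperbolic_in F finite_hyperbolic hyperbolic_orbit_finite by (auto simp: Q_def)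
  have sub: "subgroup A G" unfolding A_def by (rule subgroup_fixator[OF Q(1)])
  have fin: "finite (rcosets A)" unfolding A_def by (rule finite_index_fixator[OF Q])
  have comm: "a \<otimes> b = b \<otimes> a" if ab: "a \<in> A" "b \<in> A" for a b
  proof (rule apply_ext)
    have c: "a \<in> carrier G" "b \<in> carrier G" using ab by (auto simp: A_def)
    then show "a \<otimes> b \<in> carrier G" "b \<otimes> a \<in> carrier G" by auto
    fix x assume x: "x \<in> K"
    then obtain p where p: "p \<in> F" "x \<in> C (u p)" using F by blast
    then have pK: "p \<in> K" using F by blast
    consider "tame (u p)" "finite (orb p)"
      | g f v w z where "g \<in> carrier G" "attracts f v w z" "g ` C (u p) \<subseteq> C v"
      using u[OF pK] by blast
    then have "a (b x) = b (a x)"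
    proof cases
      case 1
      have up: "u p \<in> W" "p \<in> C (u p)" using u[OF pK] by auto
      have "p \<in> Q" using 1 p by (simp add: Q_def)
      then have fix_p: "a p = p" "b p = p" using ab by (auto simp: A_def)
      have "a x = x"
        by (rule tame_return[OF up(1) 1(1) c(1) up(2) _ p(2)]) (use fix_p up in simp)
      moreover have "b x = x"
        by (rule tame_return[OF up(1) 1(1) c(2) up(2) _ p(2)]) (use fix_p up in simp)
      ultimately show ?thesis by simp
    next
      case 2
      \<comment> \<open>Elements of \<open>A\<close> fix the hyperbolic point \<open>y\<close>, so
        their conjugates by \<open>g\<close> fix \<open>z\<close>, as
        \<open>commute_on_basin\<close> requires.\<close>
      define y where "y = (inv g) z"
      have zK: "z \<in> K" using attractsD(6)[OF 2(2)] .
      have "hyperbolic y" unfolding y_def using hyperbolic_image 2(1,2) hyperbolic_def by blast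
      then have fix_y: "a y = y" "b y = y" using ab by (auto simp: A_def Q_def)
      have yK: "y \<in> K" using \<open>hyperbolic y\<close> hyperbolic_in by blast
      have gy: "g y = z" using inv_apply(2)[OF 2(1) zK] by (simp add: y_def)
      have conj: "(g \<otimes> c \<otimes> inv g) (g t) = g (c t)" if "c \<in> carrier G" "t \<in> K" for c t
        using that 2(1) apply_closed by (simp add: mult_apply inv_apply)
      let ?a = "g \<otimes> a \<otimes> inv g" and ?b = "g \<otimes> b \<otimes> inv g"
      have "?a (?b (g x)) = ?b (?a (g x))"
      proof (rule commute_on_basin[OF 2(2)])
        show "?a z = z" "?b z = z" using conj[OF _ yK] c fix_y gy by metis+
        show "g x \<in> C v" using p(2) 2(3) by blast
      qed (use c 2(1) in auto)
      then have "g (a (b x)) = g (b (a x))" using conj c x apply_closed by simp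
      then show ?thesis using apply_inj[OF 2(1)] c x apply_closed by simp
    qed
    then show "(a \<otimes> b) x = (b \<otimes> a) x" using mult_apply c x by simp
  qed
  have "comm_group (G\<lparr>carrier := A\<rparr>)"
    by (rule group.group_comm_groupI[OF subgroup.subgroup_is_group[OF sub group_axioms]])
      (use comm in auto)
  then show ?thesis unfolding virtually_abelian_def using sub fin by blast
qed

end

section \<open>The Higman-Thompson group\<close>

lemma affine_between_inverse:
  assumes "affine_between f A B" "\<And>x. x \<in> A \<Longrightarrow> f' (f x) = x"
  shows "affine_between f' B A"
proof -
  obtain c d where c: "c > 0" and im: "(\<lambda>x. c * x + d) ` A = B" and f: "\<And>x. x \<in> A \<Longrightarrow> f x = c * x + d"
    using assms(1) unfolding affine_between_def by blast
  have inv: "(1 / c) * (c * x + d) + - d / c = x" for x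
    using c by (simp add: field_simps)
  have "(\<lambda>y. (1 / c) * y + - d / c) ` B = A"
    unfolding im[symmetric] image_image inv by simp
  moreover have "f' y = (1 / c) * y + - d / c" if y: "y \<in> B" for y
  proof -
    obtain x where x: "x \<in> A" "y = c * x + d" using y im by blast
    then show ?thesis using f[OF x(1)] assms(2)[OF x(1)] inv[of x] by simp
  qed
  ultimately show ?thesis unfolding affine_between_def using c
    by (intro exI[of _ "1 / c"] exI[of _ "- d / c"]) auto
qed

lemma homeomorphism_bij_betw: "homeomorphism S T f g \<Longrightarrow> bij_betw f S T"
  unfolding homeomorphism_def by (intro bij_betw_byWitness[of S g f T]) auto

lemma higman_thompson_Bij: "f \<in> carrier (higman_thompson n) \<Longrightarrow> f \<in> Bij (cantor_set n)"
  using homeomorphism_bij_betw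
  by (auto simp: higman_thompson_def higman_thompson_map_def Bij_def)

text \<open>The inverse exchanges the two partitions and uses the inverse permutation.\<close>

lemma higman_thompson_map_inverse:
  assumes "higman_thompson_map n f"
  shows "higman_thompson_map n (\<lambda>x\<in>cantor_set n. inv_into (cantor_set n) f x)"
    (is "higman_thompson_map n ?g")
proof -
  let ?K = "cantor_set n"
  obtain g where hom: "homeomorphism ?K ?K f g"
    using assms unfolding higman_thompson_map_def by blast
  obtain m :: nat and I J \<sigma> where
    int: "\<forall>i\<in>{1..m}. cantor_interval n (I i) \<and> cantor_interval n (J i)"
    and I: "inj_on I {1..m}" "partition_on ?K (I ` {1..m})"
    and J: "inj_on J {1..m}" "partition_on ?K (J ` {1..m})"
    and \<sigma>: "\<sigma> permutes {1..m}" and aff: "\<forall>i\<in>{1..m}. affine_between f (I i) (J (\<sigma> i))"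
    using assms unfolding higman_thompson_map_def by metis
  let ?\<tau> = "inv_into UNIV \<sigma>"
  have bij: "bij_betw f ?K ?K" using homeomorphism_bij_betw[OF hom] .
  have left: "?g (f x) = x" if "x \<in> ?K" for x
    using that bij bij_betw_inv_into_left[OF bij] by (auto simp: bij_betw_def)
  have gg: "?g x = g x" if "x \<in> ?K" for x
  proof -
    have "g x \<in> ?K" "f (g x) = x" using hom that by (auto simp: homeomorphism_def)
    then show ?thesis using left[of "g x"] by simp
  qed
  have "homeomorphism ?K ?K ?g f"
    by (rule homeomorphism_cong[OF homeomorphism_symD[OF hom]]) (use gg in auto)
  moreover have "affine_between ?g (J i) (I (?\<tau> i))" if i: "i \<in> {1..m}" for i
  proof -
    have "?\<tau> i \<in> {1..m}" using permutes_in_image[OF permutes_inv[OF \<sigma>]] i by blast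
    moreover have "\<sigma> (?\<tau> i) = i" using permutes_inverses(1)[OF \<sigma>] .
    ultimately have a: "affine_between f (I (?\<tau> i)) (J i)" using aff by metis
    have "I (?\<tau> i) \<subseteq> ?K" using partition_onD1[OF I(2)] \<open>?\<tau> i \<in> {1..m}\<close> by blast
    then show ?thesis using left by (intro affine_between_inverse[OF a]) blast
  qed
  ultimately show ?thesis unfolding higman_thompson_map_def
    using int I J permutes_inv[OF \<sigma>] by blast
qed

text \<open>The inverse in \<open>higman_thompson n\<close> is a description over its own carrier.
  Since the inverse bijection lies in that carrier, it agrees with the inverse in
  \<open>BijGroup\<close>, so \<open>H\<close> is a subgroup of a known group.\<close>

lemma subgroup_higman_thompson_Bij:
  assumes "subgroup H (higman_thompson n)"
  shows "subgroup H (BijGroup (cantor_set n))"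
proof -
  let ?B = "BijGroup (cantor_set n)" and ?T = "higman_thompson n"
  interpret B: group ?B by (rule group_BijGroup)
  have mult: "mult ?T = mult ?B" and one: "one ?T = one ?B"
    by (simp_all add: higman_thompson_def)
  have sub: "carrier ?T \<subseteq> carrier ?B" using higman_thompson_Bij by (auto simp: BijGroup_def)
  have inv: "m_inv ?T f = m_inv ?B f" if f: "f \<in> carrier ?T" for f
  proof -
    have fB: "f \<in> carrier ?B" using f sub by blast
    have "m_inv ?B f = (\<lambda>x\<in>cantor_set n. inv_into (cantor_set n) f x)"
      using inv_BijGroup higman_thompson_Bij[OF f] by blast
    then have "m_inv ?B f \<in> carrier ?T"
      using f higman_thompson_map_inverse by (simp add: higman_thompson_def)
    then show ?thesis unfolding m_inv_def[of ?T] mult one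
      using fB sub by (intro the_equality) (auto intro: B.inv_equality[symmetric])
  qed
  show ?thesis
    using subgroup.subset[OF assms] subgroup.m_closed[OF assms] subgroup.one_closed[OF assms]
      subgroup.m_inv_closed[OF assms] sub inv
    by (intro subgroup.intro) (auto simp: mult one subset_iff)
qed

context cantor_coding
begin

text \<open>A word at least as long as every word of the source partition extends one of them, and
  the common tail is kept by \<open>f\<close>. The sum of the lengths is a convenient bound.\<close>

lemma higman_thompson_uniformly_affine:
  assumes "higman_thompson_map n f"
  shows "\<exists>N. \<forall>w\<in>W. N \<le> length w \<longrightarrow> (\<exists>v\<in>W. replaces_prefix n f w v)"
proof -
  obtain m :: nat and I J \<sigma> where
    int: "\<forall>i\<in>{1..m}. cantor_interval n (I i) \<and> cantor_interval n (J i)"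
    and part: "partition_on K (I ` {1..m})"
    and \<sigma>: "\<sigma> permutes {1..m}" and aff: "\<forall>i\<in>{1..m}. affine_between f (I i) (J (\<sigma> i))"
    using assms unfolding higman_thompson_map_def by metis
  have "\<forall>i\<in>{1..m}. \<exists>u\<in>W. I i = C u" "\<forall>i\<in>{1..m}. \<exists>v\<in>W. J i = C v"
    using int cantor_interval_cylinder by metis+
  then obtain u v where u: "\<And>i. i \<in> {1..m} \<Longrightarrow> u i \<in> W \<and> I i = C (u i)"
    and v: "\<And>i. i \<in> {1..m} \<Longrightarrow> v i \<in> W \<and> J i = C (v i)" by metis
  define N where "N = (\<Sum>i\<in>{1..m}. length (u i))"
  have "\<exists>v\<in>W. replaces_prefix n f w v" if w: "w \<in> W" "N \<le> length w" for w
  proof -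
    have w0: "\<phi> w 0 \<in> C w" using zero_one_mem by (auto simp: cylinder_def)
    then have "\<phi> w 0 \<in> \<Union> (I ` {1..m})"
      using partition_onD1[OF part] cylinder_subset w(1) by blast
    then obtain i where i: "i \<in> {1..m}" "\<phi> w 0 \<in> C (u i)" using u by auto
    have "length (u i) \<le> length w"
      using member_le_sum[OF i(1), of "\<lambda>i. length (u i)"] w(2) by (simp add: N_def)
    then obtain s where s: "s \<in> W" "w = u i @ s"
      using cylinders_meet[of "u i" w] u[OF i(1)] w(1) i(2) w0 by blast
    have \<sigma>i: "\<sigma> i \<in> {1..m}" using permutes_in_image[OF \<sigma>] i(1) by blast
    then have "affine_between f (C (u i)) (C (v (\<sigma> i)))" using aff u v i(1) by metis
    then have "f (\<phi> (u i) t) = \<phi> (v (\<sigma> i)) t" if "t \<in> K" for t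
      using affine_between_cylinders u[OF i(1)] v[OF \<sigma>i] that by blast
    then have "replaces_prefix n f w (v (\<sigma> i) @ s)"
      unfolding replaces_prefix_def s(2) cantor_map_append using cantor_map_in[OF s(1)] by blast
    moreover have "v (\<sigma> i) @ s \<in> W" using v[OF \<sigma>i] s(1) by simp
    ultimately show ?thesis by blast
  qed
  then show ?thesis by blast
qed

end

theorem corollary1p12:
  fixes n :: nat and H :: "(real \<Rightarrow> real) set"
  assumes "n \<ge> 2"
    and "subgroup H (higman_thompson n)"
    and "finitely_generated ((higman_thompson n)\<lparr>carrier := H\<rparr>)"
    and "\<not> (\<exists>X T. card X = 2 \<and> free_subsemigroup ((higman_thompson n)\<lparr>carrier := H\<rparr>) X T)"
  shows "virtually_abelian ((higman_thompson n)\<lparr>carrier := H\<rparr>)"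
proof -
  let ?G = "(higman_thompson n)\<lparr>carrier := H\<rparr>"
  interpret cantor_coding n by (unfold_locales) (rule assms(1))
  have G: "?G = (BijGroup K)\<lparr>carrier := H\<rparr>" by (simp add: higman_thompson_def)
  have "group ?G"
    unfolding G by (rule subgroup.subgroup_is_group[OF subgroup_higman_thompson_Bij[OF assms(2)] group_BijGroup])
  then interpret group ?G .
  have H: "f \<in> Bij K" "higman_thompson_map n f" if "f \<in> H" for f
    using that subgroup.subset[OF assms(2)] higman_thompson_Bij
      by (auto simp: higman_thompson_def)
  have mult: "mult ?G f g = compose K f g" if "f \<in> H" "g \<in> H" for f g
    using H that by (simp add: G BijGroup_def)
  have one: "one ?G = (\<lambda>x\<in>K. x)" by (simp add: G BijGroup_def)
  interpret cantor_group n ?G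
  proof
    fix f x assume f: "f \<in> carrier ?G"
    show "f x \<in> K" if "x \<in> K"
      using H(1)[of f] f that by (auto simp: Bij_def bij_betw_def)
    show "\<exists>N. \<forall>u\<in>W. N \<le> length u \<longrightarrow> (\<exists>v\<in>W. replaces_prefix n f u v)"
      using higman_thompson_uniformly_affine H(2) f by simp
    \<comment> \<open>Both maps are extensional on \<open>K\<close>, so agreement on
      \<open>K\<close> is equality.\<close>
    show "f = one ?G" if "\<And>x. x \<in> K \<Longrightarrow> f x = x"
      using H(1)[of f] f that by (intro extensionalityI[of _ K]) (auto simp: one Bij_def)
    show "(mult ?G f g) x = f (g x)" if "g \<in> carrier ?G" "x \<in> K" for g
      using mult f that by (simp add: compose_def)
  next
    show "\<exists>S. finite S \<and> S \<subseteq> carrier ?G \<and> generate ?G S = carrier ?G"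
      using assms(3) by (simp add: finitely_generated_def)
  qed (use one assms(4) in auto)
  show ?thesis by (rule virtually_abelian_carrier)
qed

end
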